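(* Let $H$ be a real Hilbert space and let $A$ be a self-adjoint linear operator on $H$ with dense domain $D(A)$ such that $$\nu:=\inf\{\langle Au,u\rangle: u\in D(A),\ |u|=1\}>0 .$$ Let $p\ge 0$ and $u_0\in D(A)$. Let $c:[0,+\infty)\to(0,+\infty)$ be a continuous function for which there are constants $\mu>0$ and $M_1$ such that $\mu\le c(t)\le M_1$ for every $t\ge 0$. Then the problem $$\frac{1}{(1+t)^p}u'(t)+c(t)Au(t)=0\quad\forall t\ge 0,\qquad u(0)=u_0,$$ has a unique global solution $u\in C^1([0,+\infty);H)\cap C^0([0,+\infty);D(A))$, and there exists a constant $C$ such that $$|u(t)|^2+|A^{1/2}u(t)|^2+|Au(t)|^2+\frac{|u'(t)|^2}{(1+t)^{2p}}\le C\exp\left(-\frac{2\mu\nu}{1+p}(1+t)^{1+p}\right)$$ for every $t\ge 0$.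
   Context: $|x|$ and $\langle x,y\rangle$ denote the norm and scalar product of $H$. The operator $A$ may be unbounded; its powers $A^\alpha$ ($\alpha\ge 0$) are defined by the spectral theorem on domains $D(A^\alpha)$, endowed with the graph norm. *)

theory Defs
  imports "HOL-Analysis.Analysis"
begin

text \<open>An unbounded operator is given by its domain \<open>D\<close> and a function \<open>A\<close>
  of which only the values on \<open>D\<close> matter.\<close>

definition linear_operator :: "'a::real_vector set \<Rightarrow> ('a \<Rightarrow> 'a) \<Rightarrow> bool" where
  "linear_operator D A \<longleftrightarrow>
     subspace D \<and>
     (\<forall>x\<in>D. \<forall>y\<in>D. A (x + y) = A x + A y) \<and>
     (\<forall>r. \<forall>x\<in>D. A (r *\<^sub>R x) = r *\<^sub>R A x)"

definition graph_on :: "'a set \<Rightarrow> ('a \<Rightarrow> 'b) \<Rightarrow> ('a \<times> 'b) set" where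
  "graph_on D A = {(x, A x) | x. x \<in> D}"

definition adjoint_graph :: "'a::real_inner set \<Rightarrow> ('a \<Rightarrow> 'a) \<Rightarrow> ('a \<times> 'a) set" where
  "adjoint_graph D A = {(y, w). \<forall>x\<in>D. inner (A x) y = inner x w}"

definition self_adjoint_operator :: "'a::real_inner set \<Rightarrow> ('a \<Rightarrow> 'a) \<Rightarrow> bool" where
  "self_adjoint_operator D A \<longleftrightarrow>
     linear_operator D A \<and> closure D = UNIV \<and> adjoint_graph D A = graph_on D A"

definition projection_valued_measure :: "(real set \<Rightarrow> 'a::real_inner \<Rightarrow> 'a) \<Rightarrow> bool" where
  "projection_valued_measure E \<longleftrightarrow>
     (\<forall>B\<in>sets borel. bounded_linear (E B) \<and>
        (\<forall>x. E B (E B x) = E B x) \<and> (\<forall>x y. inner (E B x) y = inner x (E B y))) \<and>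
     (\<forall>x. E {} x = 0) \<and> (\<forall>x. E UNIV x = x) \<and>
     (\<forall>B\<in>sets borel. \<forall>C\<in>sets borel. \<forall>x. E (B \<inter> C) x = E B (E C x)) \<and>
     (\<forall>F :: nat \<Rightarrow> real set. range F \<subseteq> sets borel \<longrightarrow> disjoint_family F \<longrightarrow>
        (\<forall>x. (\<lambda>n. E (F n) x) sums E (\<Union>n. F n) x))"

definition spectral_scalar_measure :: "(real set \<Rightarrow> 'a::real_inner \<Rightarrow> 'a) \<Rightarrow> 'a \<Rightarrow> real measure" where
  "spectral_scalar_measure E x = measure_of UNIV (sets borel) (\<lambda>B. ennreal (inner (E B x) x))"

definition spectral_integral_domain ::
    "(real set \<Rightarrow> 'a::real_inner \<Rightarrow> 'a) \<Rightarrow> (real \<Rightarrow> real) \<Rightarrow> 'a set" where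
  "spectral_integral_domain E f = {x. integrable (spectral_scalar_measure E x) (\<lambda>l. (f l)\<^sup>2)}"

text \<open>The vector \<open>(\<integral> f dE) x\<close>. By polarization, the right-hand side below is the integral
  of \<open>f\<close> against the signed measure \<open>B \<mapsto> \<langle>E B x, z\<rangle>\<close>. The domain is dense, so for \<open>x\<close>
  in the domain testing against its elements \<open>z\<close> determines the vector.\<close>

definition spectral_integral ::
    "(real set \<Rightarrow> 'a::real_inner \<Rightarrow> 'a) \<Rightarrow> (real \<Rightarrow> real) \<Rightarrow> 'a \<Rightarrow> 'a" where
  "spectral_integral E f x = (THE y. \<forall>z\<in>spectral_integral_domain E f.
     inner y z = (integral\<^sup>L (spectral_scalar_measure E (x + z)) f
                  - integral\<^sup>L (spectral_scalar_measure E (x - z)) f) / 4)"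

definition is_spectral_measure ::
    "'a::real_inner set \<Rightarrow> ('a \<Rightarrow> 'a) \<Rightarrow> (real set \<Rightarrow> 'a \<Rightarrow> 'a) \<Rightarrow> bool" where
  "is_spectral_measure D A E \<longleftrightarrow>
     projection_valued_measure E \<and>
     D = spectral_integral_domain E (\<lambda>l. l) \<and>
     (\<forall>x\<in>D. A x = spectral_integral E (\<lambda>l. l) x)"

text \<open>By the spectral theorem, a self-adjoint operator on a Hilbert space has a spectral
  measure, and its values on Borel sets are unique. Values on other sets are irrelevant
  to the integrals above but arbitrary, hence \<open>SOME\<close> and not \<open>THE\<close>.\<close>

definition spectral_measure ::
    "'a::real_inner set \<Rightarrow> ('a \<Rightarrow> 'a) \<Rightarrow> (real set \<Rightarrow> 'a \<Rightarrow> 'a)" where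
  "spectral_measure D A = (SOME E. is_spectral_measure D A E)"

text \<open>The power \<open>A\<^sup>\<alpha>\<close> of a positive self-adjoint operator. Its spectral measure vanishes
  outside the positive reals if \<open>A\<close> is bounded below by a positive constant, so that the
  values of \<open>powr\<close> at nonpositive arguments play no role.\<close>

definition operator_power ::
    "'a::real_inner set \<Rightarrow> ('a \<Rightarrow> 'a) \<Rightarrow> real \<Rightarrow> 'a \<Rightarrow> 'a" where
  "operator_power D A \<alpha> = spectral_integral (spectral_measure D A) (\<lambda>l. l powr \<alpha>)"

definition graph_norm :: "('a::real_normed_vector \<Rightarrow> 'a) \<Rightarrow> 'a \<Rightarrow> real" where
  "graph_norm A x = sqrt ((norm x)\<^sup>2 + (norm (A x))\<^sup>2)"

text \<open>\<open>u \<in> C\<^sup>0([0,\<infinity>); D(A))\<close>\<close>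

definition continuous_into_domain ::
    "'a::real_normed_vector set \<Rightarrow> ('a \<Rightarrow> 'a) \<Rightarrow> (real \<Rightarrow> 'a) \<Rightarrow> bool" where
  "continuous_into_domain D A u \<longleftrightarrow>
     (\<forall>t\<ge>0. u t \<in> D) \<and>
     (\<forall>t\<ge>0. ((\<lambda>s. graph_norm A (u s - u t)) \<longlongrightarrow> 0) (at t within {0..}))"

text \<open>The derivative on \<open>[0,\<infinity>)\<close>, one-sided at \<open>0\<close>.\<close>

abbreviation half_line_deriv :: "(real \<Rightarrow> 'a::real_normed_vector) \<Rightarrow> real \<Rightarrow> 'a" where
  "half_line_deriv u t \<equiv> vector_derivative u (at t within {0..})"

definition C1_half_line :: "(real \<Rightarrow> 'a::real_normed_vector) \<Rightarrow> bool" where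
  "C1_half_line u \<longleftrightarrow>
     (\<forall>t\<ge>0. u differentiable (at t within {0..})) \<and>
     continuous_on {0..} (half_line_deriv u)"

definition global_solution ::
    "'a::real_normed_vector set \<Rightarrow> ('a \<Rightarrow> 'a) \<Rightarrow> real \<Rightarrow> (real \<Rightarrow> real) \<Rightarrow> 'a \<Rightarrow> (real \<Rightarrow> 'a) \<Rightarrow> bool" where
  "global_solution D A p c u0 u \<longleftrightarrow>
     C1_half_line u \<and> continuous_into_domain D A u \<and>
     (\<forall>t\<ge>0. (1 / (1 + t) powr p) *\<^sub>R half_line_deriv u t + c t *\<^sub>R A (u t) = 0) \<and>
     u 0 = u0"

end

theory Submission
  imports Defs "HOL-Probability.Probability"
begin

text \<open>In the time \<open>\<phi>(t)\<close>, the integral of \<open>(1 + s) powr p * c s\<close> from \<open>0\<close> to \<open>t\<close>, the equation becomes \<open>u' = - A u\<close>, so the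
  solution is \<open>u(t) = exp (- \<phi>(t) A) u0\<close>. The spectrum of \<open>A\<close> lies in \<open>{\<nu>..}\<close>; hence \<open>A u\<close> decays like
  \<open>exp (- \<nu> \<phi>(t))\<close>, and \<open>c \<ge> \<mu>\<close> gives \<open>\<phi>(t) \<ge> \<mu> ((1 + t) powr (1 + p) - 1) / (1 + p)\<close>. The other three quantities are
  controlled by \<open>A u\<close>: the lower bound of \<open>A\<close> for \<open>u\<close>, the inequality \<open>l \<le> 1 + l\<^sup>2\<close> under the spectral
  integral for the square root, and the equation itself for \<open>u'\<close>. Uniqueness is an energy estimate:
  the norm of the difference of two solutions does not increase (\<open>global_solution_unique\<close>).

  The substance of the proof is the spectral theorem. The square root of \<open>A\<close> is defined by some spectral
  measure of \<open>A\<close>, so one must exist, and the exponential is taken in its functional calculus.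

  The operator \<open>A\<close> has a bounded inverse, and \<open>T = \<nu> A\<^sup>-\<^sup>1\<close> satisfies \<open>0 \<le> T \<le> 1\<close>. For each vector \<open>x\<close> the moments
  \<open>\<langle>T\<^sup>j x, x\<rangle>\<close> are those of a measure \<open>\<mu>\<^sub>x\<close> on \<open>{0..1}\<close>: the Bernstein weights
  \<open>(n choose k) \<langle>T\<^sup>k (1 - T)\<^sup>n\<^sup>-\<^sup>k x, x\<rangle>\<close> are nonnegative, and Helly's theorem provides a weak limit of the
  distributions that they define (\<open>moment_distribution\<close>).

  By Weierstrass' theorem a finite signed measure on \<open>{0..1}\<close> is determined by its moments. This uniqueness
  does all the algebra. It makes \<open>\<mu>\<^sub>x\<close> quadratic in \<open>x\<close>, so that integrating a bounded Borel function against
  it is the quadratic form of an operator, and it carries the product rule from polynomials to bounded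
  Borel functions (\<open>Phi_mult\<close>). The operators of indicators form a spectral measure; its image under
  \<open>t \<mapsto> \<nu> / t\<close> belongs to \<open>A\<close> (\<open>positive_spectral_family_exists\<close> and \<open>is_spectral_measure\<close>).

  The same construction, started from the indicators of Borel sets instead of polynomials, yields the
  bounded calculus of an arbitrary spectral measure, and limits of truncations yield the unbounded
  integrals (\<open>spectral_integral_limit\<close>).\<close>

section \<open>Orthogonal projection and the Riesz representation theorem\<close>

text \<open>A minimizing sequence for the distance from \<open>x\<close> to \<open>S\<close> is Cauchy by the parallelogram law; its limit
  is the foot of the perpendicular, because moving away from it along any \<open>v \<in> S\<close> cannot decrease the
  distance.\<close>

lemma closed_subspace_projection:
  fixes S :: "'a::{real_inner, complete_space} set"
  assumes "subspace S" "closed S"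
  shows "\<exists>s\<in>S. \<forall>v\<in>S. inner (x - s) v = 0"
proof -
  have ne: "S \<noteq> {}" using assms(1) subspace_0 by blast
  define d where "d = infdist x S"
  have d0: "0 \<le> d" unfolding d_def by (rule infdist_nonneg)
  have dle: "d \<le> norm (x - v)" if "v \<in> S" for v
    using infdist_le[OF that] by (simp add: d_def dist_norm)
  have "\<exists>s\<in>S. (norm (x - s))\<^sup>2 < d\<^sup>2 + 1 / real (Suc n)" for n
  proof -
    have "d < sqrt (d\<^sup>2 + 1 / real (Suc n))"
      by (rule real_less_rsqrt) simp
    then have "(INF a\<in>S. dist x a) < sqrt (d\<^sup>2 + 1 / real (Suc n))"
      using infdist_notempty[OF ne, of x] by (simp add: d_def)
    then obtain s where "s \<in> S" "dist x s < sqrt (d\<^sup>2 + 1 / real (Suc n))"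
      using cInf_lessD[of "dist x ` S"] ne by blast
    then have "(norm (x - s))\<^sup>2 < (sqrt (d\<^sup>2 + 1 / real (Suc n)))\<^sup>2"
      by (intro power_strict_mono) (auto simp: dist_norm)
    then show ?thesis using \<open>s \<in> S\<close> by (auto simp: real_sqrt_pow2)
  qed
  then obtain s where sS: "\<And>n. s n \<in> S"
    and s: "\<And>n. (norm (x - s n))\<^sup>2 < d\<^sup>2 + 1 / real (Suc n)" by metis
  have diff: "(norm (s n - s m))\<^sup>2 \<le> 2 / real (Suc n) + 2 / real (Suc m)" for n m
  proof -
    \<comment> \<open>The midpoint of two almost nearest points lies in \<open>S\<close>, so the parallelogram law
      forces the two points together.\<close>
    have "(1/2) *\<^sub>R (s n + s m) \<in> S"
      using assms(1) sS by (simp add: subspace_add subspace_scale)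
    then have "d\<^sup>2 \<le> (norm (x - (1/2) *\<^sub>R (s n + s m)))\<^sup>2"
      using dle d0 by (intro power_mono) auto
    moreover have "(norm (s n - s m))\<^sup>2 + 4 * (norm (x - (1/2) *\<^sub>R (s n + s m)))\<^sup>2
        = 2 * (norm (x - s n))\<^sup>2 + 2 * (norm (x - s m))\<^sup>2"
      unfolding power2_norm_eq_inner by (simp add: inner_simps inner_commute field_simps)
    ultimately show ?thesis using s[of n] s[of m] by argo
  qed
  have "Cauchy s"
  proof (rule metric_CauchyI)
    fix e :: real assume e: "0 < e"
    obtain N where N: "4 / e\<^sup>2 < real N" using reals_Archimedean2 by blast
    have "dist (s m) (s n) < e" if "m \<ge> N" "n \<ge> N" for m n
    proof -
      have Np: "0 < real N" using N e by (smt (verit) divide_pos_pos zero_less_power)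
      have "2 / real (Suc k) \<le> 2 / real N" if "k \<ge> N" for k
        using that Np by (intro divide_left_mono) auto
      then have "(norm (s m - s n))\<^sup>2 \<le> 4 / real N"
        using diff[of m n] that \<open>m \<ge> N\<close> by (smt (verit) add_divide_distrib)
      also have "\<dots> < e\<^sup>2" using N Np e by (simp add: field_simps)
      finally show ?thesis using e by (simp add: dist_norm power2_less_imp_less)
    qed
    then show "\<exists>M. \<forall>m\<ge>M. \<forall>n\<ge>M. dist (s m) (s n) < e" by blast
  qed
  then obtain l where l: "s \<longlonglongrightarrow> l" using Cauchy_convergent convergent_def by blast
  have lS: "l \<in> S" using closed_sequentially[OF assms(2)] sS l by blast
  have "(\<lambda>n. (norm (x - s n))\<^sup>2) \<longlonglongrightarrow> (norm (x - l))\<^sup>2" by (intro tendsto_intros l)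
  moreover have "(\<lambda>n. d\<^sup>2 + 1 / real (Suc n)) \<longlonglongrightarrow> d\<^sup>2 + 0"
    by (intro tendsto_add tendsto_const LIMSEQ_Suc[OF lim_1_over_n])
  ultimately have ld: "(norm (x - l))\<^sup>2 \<le> d\<^sup>2"
    using s by (intro LIMSEQ_le[of _ "(norm (x - l))\<^sup>2"]) (auto intro: less_imp_le)
  have "inner (x - l) v = 0" if v: "v \<in> S" for v
  proof (cases "v = 0")
    case False
    define r where "r = inner (x - l) v / inner v v"
    have "l + r *\<^sub>R v \<in> S" using assms(1) lS v by (simp add: subspace_add subspace_scale)
    then have "d\<^sup>2 \<le> (norm (x - (l + r *\<^sub>R v)))\<^sup>2" using dle d0 by (intro power_mono) auto
    with ld have "inner (x - l) (x - l) \<le> inner (x - l - r *\<^sub>R v) (x - l - r *\<^sub>R v)"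
      by (simp add: power2_norm_eq_inner diff_diff_eq)
    also have "\<dots> = inner (x - l) (x - l) - 2 * r * inner (x - l) v + r * r * inner v v"
      by (simp add: inner_simps inner_commute algebra_simps)
    also have "\<dots> = inner (x - l) (x - l) - (inner (x - l) v)\<^sup>2 / inner v v"
      using False by (simp add: r_def power2_eq_square field_simps)
    finally have "(inner (x - l) v)\<^sup>2 / inner v v \<le> 0" by simp
    then show ?thesis using False inner_gt_zero_iff[of v]
      by (smt (verit) divide_pos_pos zero_less_power2)
  qed simp
  with lS show ?thesis by blast
qed

text \<open>The representing vector is normal to the kernel of \<open>f\<close>, which has codimension at most one.\<close>

theorem Riesz_representation:
  fixes f :: "'a::{real_inner, complete_space} \<Rightarrow> real"
  assumes "bounded_linear f"
  shows "\<exists>y. \<forall>x. f x = inner y x"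
proof (cases "\<forall>x. f x = 0")
  case True
  then show ?thesis by (intro exI[of _ 0]) simp
next
  case False
  interpret f: bounded_linear f by fact
  define S where "S = {x. f x = 0}"
  have "subspace S" unfolding S_def subspace_def by (simp add: f.add f.scaleR f.zero)
  moreover have "closed S"
    unfolding S_def by (intro closed_Collect_eq continuous_intros f.continuous_on)
  ultimately have P: "\<And>x. \<exists>s\<in>S. \<forall>v\<in>S. inner (x - s) v = 0"
    using closed_subspace_projection by blast
  obtain x s where x: "f x \<noteq> 0" and s: "s \<in> S" "\<forall>v\<in>S. inner (x - s) v = 0"
    using False P by blast
  define z where "z = x - s"
  have fz: "f z \<noteq> 0" using x s by (simp add: z_def f.diff S_def)
  then have z0: "inner z z \<noteq> 0" using f.zero by auto
  have "f y = inner ((f z / inner z z) *\<^sub>R z) y" for y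
  proof -
    have "y - (f y / f z) *\<^sub>R z \<in> S" using fz by (simp add: S_def f.diff f.scaleR)
    then have "inner z (y - (f y / f z) *\<^sub>R z) = 0" using s unfolding z_def by blast
    then show ?thesis using fz z0 by (simp add: inner_simps field_simps)
  qed
  then show ?thesis by blast
qed

lemma eq_of_inner_eq:
  fixes u v :: "'a::real_inner"
  assumes "\<And>y. inner u y = inner v y"
  shows "u = v"
proof -
  have "inner (u - v) (u - v) = 0" by (simp add: inner_diff_left assms)
  then show ?thesis by simp
qed

text \<open>Operators arise below only through their quadratic forms; this turns a form back into an operator.\<close>

lemma bounded_bilinear_form_operator:
  fixes b :: "'a::{real_inner, complete_space} \<Rightarrow> 'a \<Rightarrow> real"
  assumes add1: "\<And>x x' y. b (x + x') y = b x y + b x' y"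
    and sc1: "\<And>r x y. b (r *\<^sub>R x) y = r * b x y"
    and sym: "\<And>x y. b x y = b y x"
    and bound: "\<And>x y. \<bar>b x y\<bar> \<le> K * norm x * norm y"
  shows "\<exists>G. bounded_linear G \<and> (\<forall>x y. inner (G x) y = b x y)"
proof -
  have "bounded_linear (b x)" for x
  proof (rule bounded_linear_intro[where K = "K * norm x"])
    show "b x (y + y') = b x y + b x y'" for y y' using add1[of y y' x] by (simp add: sym)
    show "b x (r *\<^sub>R y) = r *\<^sub>R b x y" for r y using sc1[of r y x] by (simp add: sym)
    show "norm (b x y) \<le> norm y * (K * norm x)" for y
      using bound[of x y] by (simp add: mult.commute mult.left_commute)
  qed
  then have "\<forall>x. \<exists>z. \<forall>y. b x y = inner z y" using Riesz_representation by blast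
  then obtain G where "\<forall>x. \<forall>y. b x y = inner (G x) y" by metis
  then have G: "b x y = inner (G x) y" for x y by simp
  have "bounded_linear G"
  proof (rule bounded_linear_intro[where K = K])
    show "G (x + x') = G x + G x'" for x x'
      by (rule eq_of_inner_eq) (simp add: inner_add_left add1 flip: G)
    show "G (r *\<^sub>R x) = r *\<^sub>R G x" for r x
      by (rule eq_of_inner_eq) (simp add: sc1 flip: G)
    show "norm (G x) \<le> norm x * K" for x
    proof (cases "G x = 0")
      case True
      have "0 \<le> K * norm x * norm x" using bound[of x x] by linarith
      then have "0 \<le> norm x * K" by (cases "x = 0") (auto simp: zero_le_mult_iff)
      then show ?thesis using True by simp
    next
      case False
      have "norm (G x) * norm (G x) = inner (G x) (G x)" by (simp add: dot_square_norm power2_eq_square)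
      also have "\<dots> \<le> K * norm x * norm (G x)" using bound[of x "G x"] by (simp add: G[symmetric])
      finally show ?thesis using False by (simp add: mult.commute)
    qed
  qed
  then show ?thesis using G[symmetric] by blast
qed

section \<open>Functionals continuous under bounded convergence\<close>

definition bounded_borel :: "(real \<Rightarrow> real) \<Rightarrow> bool" where
  "bounded_borel g \<longleftrightarrow> g \<in> borel_measurable borel \<and> (\<exists>K. \<forall>t. \<bar>g t\<bar> \<le> K)"

text \<open>Such an \<open>L\<close> is integration against a finite signed measure carried by \<open>S\<close>. Working with the
  functional makes sums, differences, weights and images of signed measures trivial to form, and the
  uniqueness arguments below compare exactly such combinations.\<close>

definition sigma_functional :: "real set \<Rightarrow> ((real \<Rightarrow> real) \<Rightarrow> real) \<Rightarrow> bool" where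
  "sigma_functional S L \<longleftrightarrow>
     (\<forall>f g. bounded_borel f \<longrightarrow> bounded_borel g \<longrightarrow> L (\<lambda>t. f t + g t) = L f + L g) \<and>
     (\<forall>r f. bounded_borel f \<longrightarrow> L (\<lambda>t. r * f t) = r * L f) \<and>
     (\<forall>f g. bounded_borel f \<longrightarrow> bounded_borel g \<longrightarrow> (\<forall>t\<in>S. f t = g t) \<longrightarrow> L f = L g) \<and>
     (\<forall>F f K. (\<forall>n. F n \<in> borel_measurable borel) \<longrightarrow> (\<forall>n t. \<bar>F n t\<bar> \<le> K) \<longrightarrow>
        (\<forall>t. (\<lambda>n. F n t) \<longlonglongrightarrow> f t) \<longrightarrow> (\<lambda>n. L (F n)) \<longlonglongrightarrow> L f)"

lemma bounded_borelI:
  "g \<in> borel_measurable borel \<Longrightarrow> (\<And>t. \<bar>g t\<bar> \<le> K) \<Longrightarrow> bounded_borel g"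
  unfolding bounded_borel_def by blast

lemma bounded_borel_measurable[measurable_dest]: "bounded_borel g \<Longrightarrow> g \<in> borel_measurable borel"
  by (simp add: bounded_borel_def)

lemma bounded_borelE:
  assumes "bounded_borel g"
  obtains K where "0 \<le> K" "\<And>t. \<bar>g t\<bar> \<le> K"
proof -
  obtain K where K: "\<forall>t. \<bar>g t\<bar> \<le> K" using assms unfolding bounded_borel_def by blast
  then have "0 \<le> K" using abs_ge_zero[of "g 0"] by (meson order_trans)
  with K that show thesis by blast
qed

lemma bounded_borel_const[simp]: "bounded_borel (\<lambda>t. c)"
  by (rule bounded_borelI[of _ "\<bar>c\<bar>"]) auto

lemma bounded_borel_indicator: "B \<in> sets borel \<Longrightarrow> bounded_borel (indicator B)"
  by (rule bounded_borelI[of _ 1]) (auto simp: indicator_def)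

lemma bounded_borel_add:
  assumes "bounded_borel f" "bounded_borel g"
  shows "bounded_borel (\<lambda>t. f t + g t)"
proof -
  obtain K where K: "\<And>t. \<bar>f t\<bar> \<le> K" using assms(1) bounded_borelE by blast
  obtain K' where K': "\<And>t. \<bar>g t\<bar> \<le> K'" using assms(2) bounded_borelE by blast
  show ?thesis
  proof (rule bounded_borelI[of _ "K + K'"])
    show "(\<lambda>t. f t + g t) \<in> borel_measurable borel"
      using assms by (intro borel_measurable_add borel_measurable_times) (auto simp: bounded_borel_def)
    show "\<bar>f t + g t\<bar> \<le> K + K'" for t using K[of t] K'[of t] by linarith
  qed
qed

lemma bounded_borel_mult:
  assumes "bounded_borel f" "bounded_borel g"
  shows "bounded_borel (\<lambda>t. f t * g t)"
proof -
  obtain K where K: "0 \<le> K" "\<And>t. \<bar>f t\<bar> \<le> K" using assms(1) bounded_borelE by blast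
  obtain K' where K': "0 \<le> K'" "\<And>t. \<bar>g t\<bar> \<le> K'" using assms(2) bounded_borelE by blast
  show ?thesis
  proof (rule bounded_borelI[of _ "K * K'"])
    show "(\<lambda>t. f t * g t) \<in> borel_measurable borel"
      using assms by (intro borel_measurable_add borel_measurable_times) (auto simp: bounded_borel_def)
    show "\<bar>f t * g t\<bar> \<le> K * K'" for t using K K' by (simp add: abs_mult mult_mono)
  qed
qed

lemma bounded_borel_cmult: "bounded_borel f \<Longrightarrow> bounded_borel (\<lambda>t. r * f t)"
  by (rule bounded_borel_mult[OF bounded_borel_const])

lemma bounded_borel_diff: "bounded_borel f \<Longrightarrow> bounded_borel g \<Longrightarrow> bounded_borel (\<lambda>t. f t - g t)"
  using bounded_borel_add[OF _ bounded_borel_cmult, of f g "-1"] by simp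

lemma bounded_borel_power2: "bounded_borel f \<Longrightarrow> bounded_borel (\<lambda>t. (f t)\<^sup>2)"
  unfolding power2_eq_square by (rule bounded_borel_mult)

lemma bounded_borel_compose:
  assumes "bounded_borel f" "k \<in> borel_measurable borel"
  shows "bounded_borel (\<lambda>t. f (k t))"
proof -
  obtain K where K: "\<And>t. \<bar>f t\<bar> \<le> K" using assms(1) bounded_borelE by blast
  show ?thesis
    by (rule bounded_borelI[OF measurable_compose[OF assms(2) bounded_borel_measurable[OF assms(1)]] K])
qed

lemma bounded_borel_limit:
  assumes "\<And>n. F n \<in> borel_measurable borel" "\<And>n t. \<bar>F n t\<bar> \<le> K" "\<And>t. (\<lambda>n. F n t) \<longlonglongrightarrow> f t"
  shows "bounded_borel f"
proof (rule bounded_borelI)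
  show "f \<in> borel_measurable borel"
    using assms(1,3) by (rule borel_measurable_LIMSEQ_real[rotated])
  show "\<bar>f t\<bar> \<le> K" for t
    using assms(2) by (intro LIMSEQ_le_const2[OF tendsto_rabs[OF assms(3)]]) auto
qed

lemmas bounded_borel_intros = bounded_borel_const bounded_borel_indicator bounded_borel_add
  bounded_borel_mult bounded_borel_diff bounded_borel_power2

context
  fixes S L assumes L: "sigma_functional S L"
begin

lemma sigma_functional_add:
  "bounded_borel f \<Longrightarrow> bounded_borel g \<Longrightarrow> L (\<lambda>t. f t + g t) = L f + L g"
  by (rule L[unfolded sigma_functional_def, THEN conjunct1, rule_format])

lemma sigma_functional_cmult: "bounded_borel f \<Longrightarrow> L (\<lambda>t. r * f t) = r * L f"
  by (rule L[unfolded sigma_functional_def, THEN conjunct2, THEN conjunct1, rule_format])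

lemma sigma_functional_cong:
  "bounded_borel f \<Longrightarrow> bounded_borel g \<Longrightarrow> (\<And>t. t \<in> S \<Longrightarrow> f t = g t) \<Longrightarrow> L f = L g"
  by (rule L[unfolded sigma_functional_def, THEN conjunct2, THEN conjunct2, THEN conjunct1,
        rule_format])

lemma sigma_functional_limit:
  "(\<And>n. F n \<in> borel_measurable borel) \<Longrightarrow> (\<And>n t. \<bar>F n t\<bar> \<le> K) \<Longrightarrow>
    (\<And>t. (\<lambda>n. F n t) \<longlonglongrightarrow> f t) \<Longrightarrow> (\<lambda>n. L (F n)) \<longlonglongrightarrow> L f"
  for F :: "nat \<Rightarrow> real \<Rightarrow> real"
  by (rule L[unfolded sigma_functional_def, THEN conjunct2, THEN conjunct2, THEN conjunct2,
        rule_format])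

lemma sigma_functional_diff:
  "bounded_borel f \<Longrightarrow> bounded_borel g \<Longrightarrow> L (\<lambda>t. f t - g t) = L f - L g"
  using sigma_functional_add[OF _ bounded_borel_cmult, of f g "-1"] sigma_functional_cmult[of g "-1"]
  by simp

lemma sigma_functional_scale: "sigma_functional S (\<lambda>g. a * L g)"
  unfolding sigma_functional_def
proof (intro conjI allI impI)
  fix F :: "nat \<Rightarrow> real \<Rightarrow> real" and f K
  assume F: "\<forall>n. F n \<in> borel_measurable borel" "\<forall>n t. \<bar>F n t\<bar> \<le> K" "\<forall>t. (\<lambda>n. F n t) \<longlonglongrightarrow> f t"
  show "(\<lambda>n. a * L (F n)) \<longlonglongrightarrow> a * L f"
    by (intro tendsto_mult_left sigma_functional_limit[where K = K] F[rule_format])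
next
  fix f g :: "real \<Rightarrow> real" assume fg: "bounded_borel f" "bounded_borel g" "\<forall>t\<in>S. f t = g t"
  have "L f = L g" by (rule sigma_functional_cong[OF fg(1,2)]) (use fg(3) in blast)
  then show "a * L f = a * L g" by simp
qed (simp_all add: sigma_functional_add sigma_functional_cmult distrib_left)

lemma sigma_functional_weight:
  assumes h: "bounded_borel h"
  shows "sigma_functional S (\<lambda>g. L (\<lambda>t. h t * g t))"
  unfolding sigma_functional_def
proof (intro conjI allI impI)
  fix f g :: "real \<Rightarrow> real" and r :: real
  show "L (\<lambda>t. h t * (f t + g t)) = L (\<lambda>t. h t * f t) + L (\<lambda>t. h t * g t)"
    if "bounded_borel f" "bounded_borel g"
    using sigma_functional_add[OF bounded_borel_mult bounded_borel_mult, OF h that(1) h that(2)]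
    by (simp add: distrib_left)
  show "L (\<lambda>t. h t * (r * f t)) = r * L (\<lambda>t. h t * f t)" if "bounded_borel f"
    using sigma_functional_cmult[OF bounded_borel_mult[OF h that], of r]
    by (simp add: mult.left_commute)
  show "L (\<lambda>t. h t * f t) = L (\<lambda>t. h t * g t)"
    if "bounded_borel f" "bounded_borel g" "\<forall>t\<in>S. f t = g t"
    using that h by (intro sigma_functional_cong bounded_borel_mult) auto
next
  fix F :: "nat \<Rightarrow> real \<Rightarrow> real" and f K
  assume F: "\<forall>n. F n \<in> borel_measurable borel" "\<forall>n t. \<bar>F n t\<bar> \<le> K" "\<forall>t. (\<lambda>n. F n t) \<longlonglongrightarrow> f t"
  obtain K' where K': "0 \<le> K'" "\<And>t. \<bar>h t\<bar> \<le> K'" using h bounded_borelE by blast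
  have hm: "h \<in> borel_measurable borel" using h by (simp add: bounded_borel_def)
  show "(\<lambda>n. L (\<lambda>t. h t * F n t)) \<longlonglongrightarrow> L (\<lambda>t. h t * f t)"
  proof (rule sigma_functional_limit[where K = "K' * K"])
    show "(\<lambda>t. h t * F n t) \<in> borel_measurable borel" for n
      using F(1) hm by (intro borel_measurable_times) auto
    show "\<bar>h t * F n t\<bar> \<le> K' * K" for n t
      using F(2) K' by (simp add: abs_mult mult_mono)
    show "(\<lambda>n. h t * F n t) \<longlonglongrightarrow> h t * f t" for t using F(3) by (intro tendsto_mult_left) auto
  qed
qed

lemma sigma_functional_image:
  assumes k: "k \<in> borel_measurable borel" "\<And>t. t \<in> S \<Longrightarrow> k t \<in> S'"
  shows "sigma_functional S' (\<lambda>g. L (\<lambda>t. g (k t)))"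
  unfolding sigma_functional_def
proof (intro conjI allI impI)
  fix F :: "nat \<Rightarrow> real \<Rightarrow> real" and f K
  assume F: "\<forall>n. F n \<in> borel_measurable borel" "\<forall>n t. \<bar>F n t\<bar> \<le> K" "\<forall>t. (\<lambda>n. F n t) \<longlonglongrightarrow> f t"
  show "(\<lambda>n. L (\<lambda>t. F n (k t))) \<longlonglongrightarrow> L (\<lambda>t. f (k t))"
    using F k(1) by (intro sigma_functional_limit[where K = K]) (auto intro: measurable_compose[OF k(1)])
next
  fix f g :: "real \<Rightarrow> real" and r :: real
  show "L (\<lambda>t. f (k t) + g (k t)) = L (\<lambda>t. f (k t)) + L (\<lambda>t. g (k t))"
    if "bounded_borel f" "bounded_borel g"
    by (rule sigma_functional_add[OF bounded_borel_compose[OF that(1) k(1)]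
          bounded_borel_compose[OF that(2) k(1)]])
  show "L (\<lambda>t. r * f (k t)) = r * L (\<lambda>t. f (k t))" if "bounded_borel f"
    by (rule sigma_functional_cmult[OF bounded_borel_compose[OF that k(1)]])
  show "L (\<lambda>t. f (k t)) = L (\<lambda>t. g (k t))"
    if "bounded_borel f" "bounded_borel g" "\<forall>t\<in>S'. f t = g t"
    by (rule sigma_functional_cong[OF bounded_borel_compose[OF that(1) k(1)]
          bounded_borel_compose[OF that(2) k(1)]]) (use that(3) k(2) in blast)
qed

end

lemma sigma_functional_sum:
  assumes "sigma_functional S L" "sigma_functional S L'"
  shows "sigma_functional S (\<lambda>g. L g + L' g)"
  unfolding sigma_functional_def
proof (intro conjI allI impI)
  fix F :: "nat \<Rightarrow> real \<Rightarrow> real" and f K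
  assume F: "\<forall>n. F n \<in> borel_measurable borel" "\<forall>n t. \<bar>F n t\<bar> \<le> K" "\<forall>t. (\<lambda>n. F n t) \<longlonglongrightarrow> f t"
  show "(\<lambda>n. L (F n) + L' (F n)) \<longlonglongrightarrow> L f + L' f"
    by (intro tendsto_add sigma_functional_limit[OF assms(1), where K = K]
        sigma_functional_limit[OF assms(2), where K = K] F[rule_format])
next
  fix f g :: "real \<Rightarrow> real" assume fg: "bounded_borel f" "bounded_borel g" "\<forall>t\<in>S. f t = g t"
  have "L f = L g" by (rule sigma_functional_cong[OF assms(1) fg(1,2)]) (use fg(3) in blast)
  moreover have "L' f = L' g"
    by (rule sigma_functional_cong[OF assms(2) fg(1,2)]) (use fg(3) in blast)
  ultimately show "L f + L' f = L g + L' g" by simp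
qed (use assms in \<open>simp_all add: sigma_functional_add sigma_functional_cmult distrib_left\<close>)

lemma sigma_functional_difference:
  assumes "sigma_functional S L" "sigma_functional S L'"
  shows "sigma_functional S (\<lambda>g. L g - L' g)"
proof -
  have "sigma_functional S (\<lambda>g. L g + (-1) * L' g)"
    by (rule sigma_functional_sum[OF assms(1) sigma_functional_scale[OF assms(2)]])
  then show ?thesis by simp
qed

text \<open>For integration against a finite measure, bounded convergence is Lebesgue's theorem.\<close>

lemma sigma_functional_integral:
  assumes "finite_measure M" "sets M = sets borel" "AE t in M. t \<in> S"
  shows "sigma_functional S (\<lambda>g. integral\<^sup>L M g)"
proof -
  interpret finite_measure M by fact
  have meas: "bounded_borel g \<Longrightarrow> g \<in> borel_measurable M" for g
    using measurable_cong_sets[OF assms(2) refl] by (auto simp: bounded_borel_def)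
  have int: "integrable M g" if "bounded_borel g" for g
  proof -
    obtain K where "\<And>t. \<bar>g t\<bar> \<le> K" using \<open>bounded_borel g\<close> bounded_borelE by blast
    then show ?thesis using meas[OF that] by (intro integrable_const_bound[where B = K]) auto
  qed
  show ?thesis
    unfolding sigma_functional_def
  proof (intro conjI allI impI)
    fix f g :: "real \<Rightarrow> real" assume fg: "bounded_borel f" "bounded_borel g" "\<forall>t\<in>S. f t = g t"
    then show "integral\<^sup>L M f = integral\<^sup>L M g"
      using assms(3) meas by (intro integral_cong_AE) auto
  next
    fix F :: "nat \<Rightarrow> real \<Rightarrow> real" and f K
    assume F: "\<forall>n. F n \<in> borel_measurable borel" "\<forall>n t. \<bar>F n t\<bar> \<le> K" "\<forall>t. (\<lambda>n. F n t) \<longlonglongrightarrow> f t"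
    then have "bounded_borel f" "\<And>n. bounded_borel (F n)"
      using bounded_borel_limit[of F K f] by (auto simp: bounded_borel_def)
    then show "(\<lambda>n. integral\<^sup>L M (F n)) \<longlonglongrightarrow> integral\<^sup>L M f"
      using F meas by (intro integral_dominated_convergence[where w = "\<lambda>_. K"]) auto
  qed (auto simp: int)
qed

section \<open>Classes of functions that determine such a functional\<close>

text \<open>A bounded Borel function becomes nonnegative after adding a constant, and is then an increasing limit
  of simple functions that inherit its bound.\<close>

lemma sigma_functional_eq_0_of_indicators:
  assumes L: "sigma_functional S L" and ind: "\<And>B. B \<in> sets borel \<Longrightarrow> L (indicator B) = 0"
    and g: "bounded_borel g"
  shows "L g = 0"
proof -
  have pos: "bounded_borel u \<longrightarrow> L u = 0"
    if "u \<in> borel_measurable borel" "\<And>t. 0 \<le> u t" for u :: "real \<Rightarrow> real"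
    using that
  proof (induction u rule: borel_measurable_induct_real)
    case (set A)
    then show ?case using ind by simp
  next
    case (mult u c)
    show ?case
    proof
      assume b: "bounded_borel (\<lambda>x. c * u x)"
      show "L (\<lambda>x. c * u x) = 0"
      proof (cases "c = 0")
        case True
        then show ?thesis using sigma_functional_cmult[OF L bounded_borel_const, of 0 0] by simp
      next
        case False
        then have "bounded_borel u" using bounded_borel_cmult[OF b, of "1 / c"] by simp
        then show ?thesis using mult sigma_functional_cmult[OF L] by simp
      qed
    qed
  next
    case (add u v)
    show ?case
    proof
      assume "bounded_borel (\<lambda>x. v x + u x)"
      then obtain K where K: "\<And>t. \<bar>v t + u t\<bar> \<le> K" using bounded_borelE by blast
      have "bounded_borel u"
      proof (rule bounded_borelI[OF add(1)])
        show "\<bar>u t\<bar> \<le> K" for t using K[of t] add(2)[of t] add(4)[of t] by linarith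
      qed
      moreover have "bounded_borel v"
      proof (rule bounded_borelI[OF add(3)])
        show "\<bar>v t\<bar> \<le> K" for t using K[of t] add(2)[of t] add(4)[of t] by linarith
      qed
      ultimately show "L (\<lambda>x. v x + u x) = 0" using add sigma_functional_add[OF L] by simp
    qed
  next
    case (seq U)
    show ?case
    proof
      assume "bounded_borel u"
      then obtain K where K: "\<And>t. \<bar>u t\<bar> \<le> K" using bounded_borelE by blast
      have le: "U i t \<le> u t" for i t
        using seq(3,4) by (intro incseq_le) (auto simp: mono_def le_fun_def)
      have Ub: "\<bar>U i t\<bar> \<le> K" for i t using le[of i t] seq(2)[of i t] K[of t] by linarith
      have "L (U i) = 0" for i using seq.IH bounded_borelI[OF seq(1) Ub] by blast
      moreover have "(\<lambda>i. L (U i)) \<longlonglongrightarrow> L u"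
        using seq Ub by (intro sigma_functional_limit[OF L, where K = K]) auto
      ultimately show "L u = 0" by (simp add: LIMSEQ_const_iff)
    qed
  qed
  obtain K where K: "\<And>t. \<bar>g t\<bar> \<le> K" using g bounded_borelE by blast
  have "L (\<lambda>t. g t + K) = 0"
  proof (rule pos[rule_format])
    show "0 \<le> g t + K" for t using K[of t] by linarith
    show "bounded_borel (\<lambda>t. g t + K)" using g by (intro bounded_borel_intros)
    then show "(\<lambda>t. g t + K) \<in> borel_measurable borel" by (simp add: bounded_borel_def)
  qed
  moreover have "L (\<lambda>t. K) = 0"
    using ind[of UNIV] sigma_functional_cmult[OF L bounded_borel_const, of K 1]
    by (simp add: indicator_def[abs_def])
  ultimately show ?thesis using sigma_functional_add[OF L g bounded_borel_const, of K] by simp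
qed

text \<open>Polynomials are unbounded on the line. Composing them with the retraction onto \<open>{0..1}\<close> makes them
  bounded Borel functions without changing them where the measures live, and keeps the composition
  multiplicative.\<close>

definition clip :: "real \<Rightarrow> real" where "clip t = max 0 (min 1 t)"

lemma clip_mem: "clip t \<in> {0..1}" by (auto simp: clip_def)
lemma clip_id: "t \<in> {0..1} \<Longrightarrow> clip t = t" by (auto simp: clip_def)
lemma continuous_on_clip: "continuous_on A clip" unfolding clip_def by (intro continuous_intros)

lemma bounded_borel_continuous_clip:
  assumes f: "continuous_on {0..1} f"
  shows "bounded_borel (\<lambda>t. f (clip t))"
proof -
  have "bounded (f ` {0..1})" using f by (intro compact_imp_bounded compact_continuous_image) auto
  then obtain K where "\<forall>s\<in>{0..1}. \<bar>f s\<bar> \<le> K" unfolding bounded_iff by auto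
  moreover have "continuous_on UNIV (f \<circ> clip)"
    using f clip_mem by (intro continuous_on_compose continuous_on_clip)
      (auto intro: continuous_on_subset)
  ultimately show ?thesis
    using clip_mem borel_measurable_continuous_onI[of "f \<circ> clip"]
    by (intro bounded_borelI[of _ K]) (auto simp: comp_def)
qed

text \<open>By Weierstrass' theorem a functional carried by \<open>{0..1}\<close> that vanishes on polynomials
  vanishes on continuous functions, hence on indicators of half-lines, and these generate
  the Borel sets.\<close>

lemma sigma_functional_eq_0_of_polys:
  assumes L: "sigma_functional {0..1} L" and P: "\<And>p. L (\<lambda>t. poly p (clip t)) = 0"
    and g: "bounded_borel g"
  shows "L g = 0"
proof -
  have C: "L (\<lambda>t. f (clip t)) = 0" if f: "continuous_on {0..1} f" for f
  proof -
    have "\<exists>p. \<forall>t\<in>{0..1}. \<bar>f t - poly p t\<bar> < 1 / real (Suc n)" for n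
    proof -
      obtain q where q: "real_polynomial_function q" "\<And>x. x \<in> {0..1} \<Longrightarrow> \<bar>f x - q x\<bar> < 1 / real (Suc n)"
        using Stone_Weierstrass_real_polynomial_function[OF compact_Icc f, of "1 / real (Suc n)"]
        by auto
      obtain a N where "q = (\<lambda>x. \<Sum>i\<le>N. a i * x^i)"
        using q(1) unfolding real_polynomial_function_iff_sum by blast
      then have "q x = poly (\<Sum>i\<le>N. monom (a i) i) x" for x by (simp add: poly_sum poly_monom)
      with q(2) show ?thesis by metis
    qed
    then obtain p where p: "\<And>n t. t \<in> {0..1} \<Longrightarrow> \<bar>f t - poly (p n) t\<bar> < 1 / real (Suc n)" by metis
    have "(\<lambda>n. L (\<lambda>t. poly (p n) (clip t))) \<longlonglongrightarrow> L (\<lambda>t. f (clip t))"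
    proof -
      obtain K where K: "\<And>t. \<bar>f (clip t)\<bar> \<le> K"
        using bounded_borel_continuous_clip[OF f] bounded_borelE by blast
      show ?thesis
      proof (rule sigma_functional_limit[OF L, where K = "K + 1"])
        show "(\<lambda>t. poly (p n) (clip t)) \<in> borel_measurable borel" for n
          by (intro bounded_borel_measurable bounded_borel_continuous_clip continuous_intros)
        show "\<bar>poly (p n) (clip t)\<bar> \<le> K + 1" for n t
        proof -
          have "1 / real (Suc n) \<le> 1" by simp
          then show ?thesis using p[OF clip_mem, of t n] K[of t] by linarith
        qed
        show "(\<lambda>n. poly (p n) (clip t)) \<longlonglongrightarrow> f (clip t)" for t
        proof (rule LIM_zero_cancel, rule Lim_null_comparison)
          show "\<forall>\<^sub>F n in sequentially. norm (poly (p n) (clip t) - f (clip t)) \<le> 1 / real (Suc n)"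
            using p[OF clip_mem, of t] by (auto simp: abs_minus_commute less_imp_le)
          show "(\<lambda>n. 1 / real (Suc n)) \<longlonglongrightarrow> 0" by (rule LIMSEQ_Suc[OF lim_1_over_n])
        qed
      qed
    qed
    then show ?thesis using P by (simp add: LIMSEQ_const_iff)
  qed
  have H: "L (indicator {..a}) = 0" for a
  proof -
    \<comment> \<open>The indicator of a half-line is the limit of ramps that drop from \<open>1\<close> to \<open>0\<close> on an interval of
      length \<open>1 / n\<close>.\<close>
    define h where "h n t = max 0 (1 - real n * max 0 (t - a))" for n and t :: real
    have hc: "continuous_on A (h n)" for n A unfolding h_def by (intro continuous_intros)
    have hb: "\<bar>h n t\<bar> \<le> 1" for n t unfolding h_def by auto
    have hm: "h n \<in> borel_measurable borel" for n using borel_measurable_continuous_onI[OF hc] .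
    have "(\<lambda>n. h n t) \<longlonglongrightarrow> indicator {..a} t" for t
    proof (cases "t \<le> a")
      case True
      then show ?thesis by (simp add: h_def)
    next
      case False
      then obtain N where N: "1 / (t - a) < real N" using reals_Archimedean2 by blast
      have "h n t = 0" if "n \<ge> N" for n
      proof -
        have "1 / (t - a) \<le> real n" using N that by linarith
        then have "1 \<le> real n * (t - a)" using False by (simp add: field_simps)
        then show ?thesis using False by (simp add: h_def max_def)
      qed
      then have "\<forall>\<^sub>F n in sequentially. h n t = 0" by (auto simp: eventually_sequentially)
      then show ?thesis using False by (simp add: tendsto_eventually)
    qed
    then have "(\<lambda>n. L (h n)) \<longlonglongrightarrow> L (indicator {..a})"
      by (intro sigma_functional_limit[OF L, where K = 1] hb hm)
    moreover have "L (h n) = 0" for n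
    proof -
      have "L (h n) = L (\<lambda>t. h n (clip t))"
        by (rule sigma_functional_cong[OF L])
          (auto simp: clip_id intro: bounded_borelI[OF hm hb] bounded_borel_continuous_clip[OF hc])
      then show ?thesis using C[OF hc] by simp
    qed
    ultimately show ?thesis by (simp add: LIMSEQ_const_iff)
  qed
  have U: "L (indicator UNIV) = 0"
  proof -
    have "L (indicator UNIV) = L (indicator {..1})"
      by (rule sigma_functional_cong[OF L]) (auto intro: bounded_borel_indicator)
    then show ?thesis using H by simp
  qed
  have zero': "L (\<lambda>t. 0) = 0"
    using sigma_functional_cmult[OF L bounded_borel_const, of 0 0] by simp
  then have zero: "L (indicator {}) = 0"
    by (simp add: indicator_def[abs_def] del: indicator_simps)
  have "L (indicator B) = 0" if "B \<in> sets borel" for B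
  proof -
    let ?G = "range (\<lambda>a::real. {..a})"
    have "Int_stable ?G" by (auto simp: Int_stable_def)
    moreover have "?G \<subseteq> Pow UNIV" by simp
    moreover have "B \<in> sigma_sets UNIV ?G"
      using that by (simp add: borel_eq_atMost)
    ultimately show ?thesis
    proof (induction B rule: sigma_sets_induct_disjoint)
      case (basic A)
      then show ?case using H by auto
    next
      case empty
      then show ?case by (rule zero)
    next
      case (compl A)
      have A: "A \<in> sets borel" using compl by (simp add: borel_eq_atMost)
      have "(indicator (UNIV - A) :: real \<Rightarrow> real) = (\<lambda>t. indicator UNIV t - indicator A t)"
        by (auto simp: fun_eq_iff indicator_def)
      then show ?case
        using sigma_functional_diff[OF L bounded_borel_indicator bounded_borel_indicator, of UNIV A]
          A U compl by simp
    next
      case (union A)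
      have A: "A i \<in> sets borel" for i using union by (auto simp: borel_eq_atMost)
      have fin: "L (indicator (\<Union>i<n. A i)) = 0" for n
      proof (induction n)
        case 0
        show ?case using zero' by simp
      next
        case (Suc n)
        have "A n \<inter> A i = {}" if "i < n" for i
          using disjoint_family_onD[OF union(1), of n i] that by simp
        then have "A n \<inter> (\<Union>i<n. A i) = {}" by blast
        then have "(indicator (\<Union>i<Suc n. A i) :: real \<Rightarrow> real)
            = (\<lambda>t. indicator (A n) t + indicator (\<Union>i<n. A i) t)"
          by (auto simp: fun_eq_iff indicator_def lessThan_Suc)
        then show ?case
          using Suc union(3) A
          by (simp add: sigma_functional_add[OF L bounded_borel_indicator bounded_borel_indicator])
      qed
      have "(\<lambda>n. indicator (\<Union>i<n. A i) t :: real) \<longlonglongrightarrow> indicator (\<Union>i. A i) t" for t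
        by (rule LIMSEQ_indicator_UN)
      then have "(\<lambda>n. L (indicator (\<Union>i<n. A i))) \<longlonglongrightarrow> L (indicator (\<Union>i. A i))"
        using A by (intro sigma_functional_limit[OF L, where K = 1]) (auto simp: indicator_def)
      then show ?case using fin by (simp add: LIMSEQ_const_iff)
    qed
  qed
  then show ?thesis by (rule sigma_functional_eq_0_of_indicators[OF L _ g])
qed

section \<open>Bounded Borel functional calculus\<close>

text \<open>The data from which a calculus is generated: quadratic functionals \<open>J x\<close> and a class of
  functions \<open>e i\<close>, closed under multiplication, for which the operator \<open>P i\<close> is already
  known. The class is used with polynomials and with indicators of Borel sets.\<close>

locale calculus_seed =
  fixes S :: "real set"
    and J :: "'a::{real_inner, complete_space} \<Rightarrow> (real \<Rightarrow> real) \<Rightarrow> real"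
    and X :: "'i set" and e :: "'i \<Rightarrow> real \<Rightarrow> real" and P :: "'i \<Rightarrow> 'a \<Rightarrow> 'a"
    and m :: "'i \<Rightarrow> 'i \<Rightarrow> 'i"
  assumes J_sf: "\<And>x. sigma_functional S (J x)"
    and J_bound: "\<And>x g K. bounded_borel g \<Longrightarrow> (\<And>t. t \<in> S \<Longrightarrow> \<bar>g t\<bar> \<le> K) \<Longrightarrow> \<bar>J x g\<bar> \<le> K * (norm x)\<^sup>2"
    and e_bb: "\<And>i. i \<in> X \<Longrightarrow> bounded_borel (e i)"
    and m_mem: "\<And>i j. i \<in> X \<Longrightarrow> j \<in> X \<Longrightarrow> m i j \<in> X"
    and e_mult: "\<And>i j t. i \<in> X \<Longrightarrow> j \<in> X \<Longrightarrow> e (m i j) t = e i t * e j t"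
    and P_mult: "\<And>i j x. i \<in> X \<Longrightarrow> j \<in> X \<Longrightarrow> P (m i j) x = P i (P j x)"
    and P_add: "\<And>i x y. i \<in> X \<Longrightarrow> P i (x + y) = P i x + P i y"
    and P_scale: "\<And>i r x. i \<in> X \<Longrightarrow> P i (r *\<^sub>R x) = r *\<^sub>R P i x"
    and P_sym: "\<And>i x y. i \<in> X \<Longrightarrow> inner (P i x) y = inner x (P i y)"
    and J_e: "\<And>i x. i \<in> X \<Longrightarrow> J x (e i) = inner (P i x) x"
    and determining: "\<And>L g. sigma_functional S L \<Longrightarrow> (\<And>i. i \<in> X \<Longrightarrow> L (e i) = 0) \<Longrightarrow>
          bounded_borel g \<Longrightarrow> L g = 0"
begin

definition I :: "'a \<Rightarrow> 'a \<Rightarrow> (real \<Rightarrow> real) \<Rightarrow> real" where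
  "I x y g = (J (x + y) g - J (x - y) g) / 4"

lemma I_sf: "sigma_functional S (I x y)"
proof -
  have "sigma_functional S (\<lambda>g. (1/4) * (J (x + y) g - J (x - y) g))"
    by (intro sigma_functional_scale sigma_functional_difference J_sf)
  moreover have "(\<lambda>g. (1/4) * (J (x + y) g - J (x - y) g)) = I x y"
    by (simp add: I_def fun_eq_iff)
  ultimately show ?thesis by simp
qed

lemma I_e:
  assumes i: "i \<in> X"
  shows "I x y (e i) = inner (P i x) y"
proof -
  have "P i (x - y) = P i x - P i y"
    using P_add[OF i, of x "(-1) *\<^sub>R y"] P_scale[OF i, of "-1" y] by simp
  then have "J (x + y) (e i) - J (x - y) (e i) = 2 * inner (P i x) y + 2 * inner (P i y) x"
    unfolding J_e[OF i] P_add[OF i] \<open>P i (x - y) = P i x - P i y\<close> by (simp add: inner_simps)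
  also have "inner (P i y) x = inner (P i x) y" using P_sym[OF i, of y x] by (simp add: inner_commute)
  finally show ?thesis by (simp add: I_def)
qed

text \<open>All identities between signed measures are checked on the generating class only.\<close>

lemma sf_eqI:
  assumes "sigma_functional S L" "sigma_functional S L'"
    and "\<And>i. i \<in> X \<Longrightarrow> L (e i) = L' (e i)" and "bounded_borel g"
  shows "L g = L' g"
  using determining[OF sigma_functional_difference[OF assms(1,2)] _ assms(4)] assms(3) by simp

lemma I_sym: "bounded_borel g \<Longrightarrow> I x y g = I y x g"
proof (rule sf_eqI[OF I_sf I_sf])
  show "I x y (e i) = I y x (e i)" if "i \<in> X" for i
    unfolding I_e[OF that] P_sym[OF that, of x] by (rule inner_commute)
qed

lemma I_add: "bounded_borel g \<Longrightarrow> I (x + x') y g = I x y g + I x' y g"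
  by (rule sf_eqI[OF I_sf sigma_functional_sum[OF I_sf I_sf]])
    (simp_all add: I_e P_add inner_add_left)

lemma I_scale: "bounded_borel g \<Longrightarrow> I (r *\<^sub>R x) y g = r * I x y g"
  by (rule sf_eqI[OF I_sf sigma_functional_scale[OF I_sf]]) (simp_all add: I_e P_scale)

lemma I_diag: "bounded_borel g \<Longrightarrow> I x x g = J x g"
  by (rule sf_eqI[OF I_sf J_sf]) (simp_all add: I_e J_e)

text \<open>On unit vectors the polarization formula gives the bound \<open>K * (norm (u + v)\<^sup>2 + norm (u - v)\<^sup>2) / 4 = K\<close>;
  homogeneity does the rest.\<close>

lemma I_bound:
  assumes g: "bounded_borel g" and K: "\<And>t. t \<in> S \<Longrightarrow> \<bar>g t\<bar> \<le> K"
  shows "\<bar>I x y g\<bar> \<le> K * norm x * norm y"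
proof (cases "x = 0 \<or> y = 0")
  case True
  then have "I x y g = 0"
    using I_scale[OF g, of 0 0 y] I_scale[OF g, of 0 0 x] I_sym[OF g, of x y] by auto
  then show ?thesis using True by auto
next
  case False
  have weak: "\<bar>I u v g\<bar> \<le> K * ((norm u)\<^sup>2 + (norm v)\<^sup>2) / 2" for u v
  proof -
    have "\<bar>I u v g\<bar> \<le> (K * (norm (u + v))\<^sup>2 + K * (norm (u - v))\<^sup>2) / 4"
      using J_bound[OF g K, of "u + v"] J_bound[OF g K, of "u - v"] unfolding I_def by simp
    also have "\<dots> = K * ((norm (u + v))\<^sup>2 + (norm (u - v))\<^sup>2) / 4" by (simp add: distrib_left)
    also have "(norm (u + v))\<^sup>2 + (norm (u - v))\<^sup>2 = 2 * ((norm u)\<^sup>2 + (norm v)\<^sup>2)"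
      unfolding power2_norm_eq_inner by (simp add: inner_simps)
    finally show ?thesis by argo
  qed
  define u where "u = (1 / norm x) *\<^sub>R x"
  define v where "v = (1 / norm y) *\<^sub>R y"
  have uv: "norm u = 1" "norm v = 1" "x = norm x *\<^sub>R u" "y = norm y *\<^sub>R v"
    using False by (simp_all add: u_def v_def)
  have "I x y g = norm x * (norm y * I u v g)"
    using I_scale[OF g, of "norm x" u y] I_scale[OF g, of "norm y" v u] uv(3,4)
      I_sym[OF g, of u y] I_sym[OF g, of v u] by metis
  then have "\<bar>I x y g\<bar> = norm x * norm y * \<bar>I u v g\<bar>" by (simp add: abs_mult)
  also have "\<dots> \<le> norm x * norm y * K"
    using weak[of u v] uv(1,2) by (intro mult_left_mono) auto
  finally show ?thesis by (simp add: mult_ac)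
qed

definition Phi :: "(real \<Rightarrow> real) \<Rightarrow> 'a \<Rightarrow> 'a" where
  "Phi g = (SOME G. bounded_linear G \<and> (\<forall>x y. inner (G x) y = I x y g))"

lemma Phi_exists:
  assumes g: "bounded_borel g"
  shows "bounded_linear (Phi g) \<and> (\<forall>x y. inner (Phi g x) y = I x y g)"
proof -
  obtain K where K: "\<And>t. \<bar>g t\<bar> \<le> K" using g bounded_borelE by blast
  have "\<exists>G. bounded_linear G \<and> (\<forall>x y. inner (G x) y = I x y g)"
    by (rule bounded_bilinear_form_operator[where K = K])
      (rule I_add[OF g] I_scale[OF g] I_sym[OF g] I_bound[OF g K])+
  then show ?thesis unfolding Phi_def by (rule someI_ex)
qed

lemma bounded_linear_Phi: "bounded_borel g \<Longrightarrow> bounded_linear (Phi g)"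
  using Phi_exists by blast

lemma inner_Phi: "bounded_borel g \<Longrightarrow> inner (Phi g x) y = I x y g"
  using Phi_exists by blast

lemma Phi_e: "i \<in> X \<Longrightarrow> Phi (e i) x = P i x"
  by (rule eq_of_inner_eq) (simp add: inner_Phi e_bb I_e)

lemma Phi_sym: "bounded_borel g \<Longrightarrow> inner (Phi g x) y = inner x (Phi g y)"
  by (simp only: inner_Phi inner_commute[of x "Phi g y"] I_sym[of g x y])

lemma Phi_add: "bounded_borel f \<Longrightarrow> bounded_borel g \<Longrightarrow> Phi (\<lambda>t. f t + g t) x = Phi f x + Phi g x"
  by (rule eq_of_inner_eq)
    (simp add: inner_add_left inner_Phi bounded_borel_add sigma_functional_add[OF I_sf])

lemma Phi_cmult: "bounded_borel f \<Longrightarrow> Phi (\<lambda>t. r * f t) x = r *\<^sub>R Phi f x"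
  by (rule eq_of_inner_eq)
    (simp add: inner_Phi bounded_borel_cmult sigma_functional_cmult[OF I_sf])

lemma Phi_diff: "bounded_borel f \<Longrightarrow> bounded_borel g \<Longrightarrow> Phi (\<lambda>t. f t - g t) x = Phi f x - Phi g x"
  by (rule eq_of_inner_eq)
    (simp add: inner_diff_left inner_Phi bounded_borel_diff sigma_functional_diff[OF I_sf])

lemma Phi_cong:
  assumes "bounded_borel f" "bounded_borel g" "\<And>t. t \<in> S \<Longrightarrow> f t = g t"
  shows "Phi f x = Phi g x"
  by (rule eq_of_inner_eq)
    (simp add: inner_Phi assms(1,2) sigma_functional_cong[OF I_sf assms])

text \<open>Multiplicativity spreads from the generating class in two steps, one for each factor. The
  measures \<open>f \<cdot> I x y\<close> and \<open>I x (Phi f y)\<close> agree on the class, so they are equal.\<close>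

lemma Phi_mult:
  assumes f: "bounded_borel f" and g: "bounded_borel g"
  shows "Phi (\<lambda>t. f t * g t) x = Phi f (Phi g x)"
proof (rule eq_of_inner_eq)
  fix y
  have first: "I x y (\<lambda>t. e i t * f t) = I x (Phi f y) (e i)" if i: "i \<in> X" for i
  proof -
    have "I x y (\<lambda>t. e i t * f t) = I (P i x) y f"
    proof (rule sf_eqI[OF sigma_functional_weight[OF I_sf e_bb[OF i]] I_sf _ f])
      fix j assume j: "j \<in> X"
      have "(\<lambda>t. e i t * e j t) = e (m j i)" using i j by (simp add: e_mult fun_eq_iff)
      then show "I x y (\<lambda>t. e i t * e j t) = I (P i x) y (e j)"
        using i j by (simp add: I_e m_mem P_mult)
    qed
    also have "\<dots> = inner (P i x) (Phi f y)" by (simp add: inner_Phi[OF f, symmetric] Phi_sym[OF f])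
    finally show ?thesis using i by (simp add: I_e)
  qed
  have "I x y (\<lambda>t. f t * g t) = I x (Phi f y) g"
  proof (rule sf_eqI[OF sigma_functional_weight[OF I_sf f] I_sf _ g])
    fix i assume "i \<in> X"
    then show "I x y (\<lambda>t. f t * e i t) = I x (Phi f y) (e i)"
      using first[of i] by (simp add: mult.commute)
  qed
  then show "inner (Phi (\<lambda>t. f t * g t) x) y = inner (Phi f (Phi g x)) y"
    by (simp add: inner_Phi[OF bounded_borel_mult[OF f g]] inner_Phi[OF g, symmetric] Phi_sym[OF f])
qed

lemma norm_Phi:
  assumes g: "bounded_borel g"
  shows "(norm (Phi g x))\<^sup>2 = J x (\<lambda>t. (g t)\<^sup>2)"
proof -
  have "(norm (Phi g x))\<^sup>2 = inner (Phi g (Phi g x)) x"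
    by (simp add: power2_norm_eq_inner Phi_sym[OF g, of "Phi g x" x])
  also have "\<dots> = I x x (\<lambda>t. g t * g t)"
    by (simp add: Phi_mult[OF g g, symmetric] inner_Phi bounded_borel_mult[OF g g])
  finally show ?thesis by (simp add: I_diag bounded_borel_mult[OF g g] power2_eq_square)
qed

lemma norm_Phi_le:
  assumes g: "bounded_borel g" and K: "\<And>t. t \<in> S \<Longrightarrow> \<bar>g t\<bar> \<le> K" and K0: "0 \<le> K"
  shows "norm (Phi g x) \<le> K * norm x"
proof -
  have "\<bar>(g t)\<^sup>2\<bar> \<le> K\<^sup>2" if "t \<in> S" for t
    using K[OF that] power_mono[of "\<bar>g t\<bar>" K 2] by simp
  then have "J x (\<lambda>t. (g t)\<^sup>2) \<le> K\<^sup>2 * (norm x)\<^sup>2"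
    using abs_le_D1[OF J_bound[OF bounded_borel_power2[OF g]]] by blast
  then have "(norm (Phi g x))\<^sup>2 \<le> (K * norm x)\<^sup>2" by (simp add: norm_Phi[OF g] power_mult_distrib)
  then show ?thesis by (rule power2_le_imp_le) (use K0 in simp)
qed

text \<open>Strong convergence under bounded convergence of the functions: the squared norm of the error is
  \<open>J x\<close> of the squared error.\<close>

lemma Phi_limit:
  assumes F: "\<And>n. F n \<in> borel_measurable borel" "\<And>n t. \<bar>F n t\<bar> \<le> K"
    "\<And>t. (\<lambda>n. F n t) \<longlonglongrightarrow> f t"
  shows "(\<lambda>n. Phi (F n) x) \<longlonglongrightarrow> Phi f x"
proof -
  have f: "bounded_borel f" by (rule bounded_borel_limit[OF F])
  have Fb: "bounded_borel (F n)" for n by (rule bounded_borelI[OF F(1,2)])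
  have Db: "bounded_borel (\<lambda>t. (F n t - f t)\<^sup>2)" for n
    by (intro bounded_borel_intros Fb f)
  have fK: "\<bar>f t\<bar> \<le> K" for t
    using F(2) by (intro LIMSEQ_le_const2[OF tendsto_rabs[OF F(3)]]) auto
  have "(\<lambda>n. J x (\<lambda>t. (F n t - f t)\<^sup>2)) \<longlonglongrightarrow> J x (\<lambda>t. 0)"
  proof (rule sigma_functional_limit[OF J_sf, where K = "(2 * K)\<^sup>2"])
    show "(\<lambda>t. (F n t - f t)\<^sup>2) \<in> borel_measurable borel" for n
      by (rule bounded_borel_measurable[OF Db])
    show "\<bar>(F n t - f t)\<^sup>2\<bar> \<le> (2 * K)\<^sup>2" for n t
    proof -
      have "\<bar>F n t - f t\<bar> \<le> 2 * K" using F(2)[of n t] fK[of t] by linarith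
      then show ?thesis using power_mono[of "\<bar>F n t - f t\<bar>" "2 * K" 2] by simp
    qed
    show "(\<lambda>n. (F n t - f t)\<^sup>2) \<longlonglongrightarrow> 0" for t
      using tendsto_power[OF LIM_zero[OF F(3)[of t]], of 2] by simp
  qed
  also have "J x (\<lambda>t. 0) = 0" using sigma_functional_cmult[OF J_sf bounded_borel_const, of x 0 0] by simp
  finally have "(\<lambda>n. (norm (Phi (F n) x - Phi f x))\<^sup>2) \<longlonglongrightarrow> 0"
    by (simp add: Phi_diff[OF Fb f, symmetric] norm_Phi bounded_borel_diff[OF Fb f])
  from tendsto_real_sqrt[OF this] have "(\<lambda>n. norm (Phi (F n) x - Phi f x)) \<longlonglongrightarrow> 0" by simp
  then show ?thesis by (simp add: LIM_zero_iff tendsto_norm_zero_iff)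
qed

text \<open>Countable additivity is bounded convergence for the indicators of the partial unions. The map \<open>k\<close>
  moves the spectral measure to another subset of the line.\<close>

lemma projection_valued_measure_Phi:
  assumes one: "\<And>x. J x (\<lambda>t. 1) = (norm x)\<^sup>2"
    and k: "k \<in> borel_measurable borel"
  shows "projection_valued_measure (\<lambda>B. Phi (\<lambda>t. indicator B (k t)))"
proof -
  define E where "E B = Phi (\<lambda>t. indicator B (k t))" for B
  have b: "bounded_borel (\<lambda>t. indicator B (k t))" if "B \<in> sets borel" for B
    using bounded_borel_compose[OF bounded_borel_indicator[OF that] k] .
  have zero: "Phi (\<lambda>t. 0) x = 0" for x
    using Phi_cmult[OF bounded_borel_const, of 0 0 x] by simp
  have unit: "Phi (\<lambda>t. 1) x = x" for x
  proof -
    have I1: "I u v (\<lambda>t. 1) = inner u v" for u v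
      unfolding I_def one power2_norm_eq_inner by (simp add: inner_simps inner_commute)
    show ?thesis by (rule eq_of_inner_eq) (simp add: inner_Phi I1)
  qed
  have mult: "E (B \<inter> C) x = E B (E C x)" if "B \<in> sets borel" "C \<in> sets borel" for B C x
    unfolding E_def Phi_mult[OF b[OF that(1)] b[OF that(2)], symmetric]
    by (simp add: indicator_inter_arith)
  have sums: "(\<lambda>n. E (F n) x) sums E (\<Union>n. F n) x"
    if F: "range F \<subseteq> sets borel" "disjoint_family F" for F :: "nat \<Rightarrow> real set" and x
  proof -
    have Fb: "F n \<in> sets borel" for n using F by auto
    have fin: "(\<Sum>i<n. E (F i) x) = E (\<Union>i<n. F i) x" for n
    proof (induction n)
      case 0
      then show ?case using zero[of x] by (simp add: E_def)
    next
      case (Suc n)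
      have "F n \<inter> F i = {}" if "i < n" for i
        using disjoint_family_onD[OF F(2), of n i] that by simp
      then have "F n \<inter> (\<Union>i<n. F i) = {}" by blast
      then have "(\<lambda>t. indicator (\<Union>i<Suc n. F i) (k t) :: real)
          = (\<lambda>t. indicator (\<Union>i<n. F i) (k t) + indicator (F n) (k t))"
        by (auto simp: fun_eq_iff indicator_def lessThan_Suc)
      then have "E (\<Union>i<Suc n. F i) x = E (\<Union>i<n. F i) x + E (F n) x"
        unfolding E_def using Phi_add[OF b b, of "\<Union>i<n. F i" "F n" x] Fb by auto
      then show ?case using Suc by simp
    qed
    have "(\<lambda>n. E (\<Union>i<n. F i) x) \<longlonglongrightarrow> E (\<Union>i. F i) x"
      unfolding E_def
    proof (rule Phi_limit[where K = 1])
      show "(\<lambda>t. indicator (\<Union>i<n. F i) (k t) :: real) \<in> borel_measurable borel" for n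
        by (rule bounded_borel_measurable[OF b[OF sets.finite_UN]]) (use Fb in auto)
      show "(\<lambda>n. indicator (\<Union>i<n. F i) (k t)) \<longlonglongrightarrow> (indicator (\<Union>i. F i) (k t) :: real)" for t
        by (rule LIMSEQ_indicator_UN)
    qed (simp add: indicator_def)
    then show ?thesis unfolding sums_def fin .
  qed
  have "projection_valued_measure E"
    unfolding projection_valued_measure_def
  proof (intro conjI allI ballI impI)
    fix B :: "real set" and x y :: 'a assume B: "B \<in> sets borel"
    show "bounded_linear (E B)" unfolding E_def by (rule bounded_linear_Phi[OF b[OF B]])
    show "E B (E B x) = E B x" using mult[OF B B, of x] by simp
    show "inner (E B x) y = inner x (E B y)" unfolding E_def by (rule Phi_sym[OF b[OF B]])
  next
    show "E {} x = 0" for x using zero by (simp add: E_def)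
    show "E UNIV x = x" for x using unit by (simp add: E_def)
  next
    fix B C :: "real set" and x assume "B \<in> sets borel" "C \<in> sets borel"
    then show "E (B \<inter> C) x = E B (E C x)" by (rule mult)
  next
    fix F :: "nat \<Rightarrow> real set" and x assume "range F \<subseteq> sets borel" "disjoint_family F"
    then show "(\<lambda>n. E (F n) x) sums E (\<Union>n. F n) x" by (rule sums)
  qed
  then show ?thesis unfolding E_def[abs_def] .
qed

end

section \<open>Polynomials in a bounded operator\<close>

definition opoly :: "('a::real_vector \<Rightarrow> 'a) \<Rightarrow> real poly \<Rightarrow> 'a \<Rightarrow> 'a" where
  "opoly T p = fold_coeffs (\<lambda>a f x. a *\<^sub>R x + T (f x)) p (\<lambda>_. 0)"

context
  fixes T :: "'a::real_vector \<Rightarrow> 'a" assumes T: "linear T"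
begin

lemma opoly_0: "opoly T 0 x = 0"
  by (simp add: opoly_def)

lemma opoly_pCons: "opoly T (pCons a p) x = a *\<^sub>R x + T (opoly T p x)"
  using linear_0[OF T]
  by (cases "a = 0 \<and> p = 0") (auto simp: opoly_def)

lemma opoly_add: "opoly T (p + q) x = opoly T p x + opoly T q x"
  by (induction p q rule: poly_induct2)
    (simp_all add: opoly_0 opoly_pCons linear_add[OF T] algebra_simps)

lemma opoly_smult: "opoly T (smult a p) x = a *\<^sub>R opoly T p x"
  by (induction p) (simp_all add: opoly_0 opoly_pCons linear_scale[OF T] algebra_simps)

lemma opoly_sum: "opoly T (\<Sum>i\<in>A. f i) x = (\<Sum>i\<in>A. opoly T (f i) x)"
  by (induction A rule: infinite_finite_induct) (simp_all add: opoly_0 opoly_add)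

lemma opoly_mult: "opoly T (p * q) x = opoly T p (opoly T q x)"
  by (induction p) (simp_all add: opoly_0 opoly_pCons opoly_add opoly_smult)

lemma opoly_1: "opoly T 1 x = x"
  by (simp add: one_pCons opoly_pCons opoly_0 linear_0[OF T])

lemma opoly_X: "opoly T [:0, 1:] x = T x"
  by (simp add: opoly_pCons opoly_0 linear_0[OF T])

lemma opoly_add_arg: "opoly T p (x + y) = opoly T p x + opoly T p y"
  by (induction p) (simp_all add: opoly_0 opoly_pCons linear_add[OF T] algebra_simps)

lemma opoly_scale_arg: "opoly T p (r *\<^sub>R x) = r *\<^sub>R opoly T p x"
  by (induction p) (simp_all add: opoly_0 opoly_pCons linear_scale[OF T] algebra_simps)

lemma opoly_altdef: "opoly T p x = (\<Sum>i\<le>degree p. coeff p i *\<^sub>R opoly T ([:0, 1:] ^ i) x)"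
proof -
  have "opoly T p x = opoly T (\<Sum>i\<le>degree p. monom (coeff p i) i) x"
    by (simp add: poly_as_sum_of_monoms)
  also have "\<dots> = (\<Sum>i\<le>degree p. coeff p i *\<^sub>R opoly T ([:0, 1:] ^ i) x)"
    by (simp add: opoly_sum monom_altdef opoly_smult)
  finally show ?thesis .
qed

end

lemma opoly_sym:
  assumes T: "linear T" and sym: "\<And>x y. inner (T x) y = inner x (T y)"
  shows "inner (opoly T p x) y = inner x (opoly T p y)"
proof (induction p arbitrary: x y)
  case 0
  then show ?case by (simp add: opoly_0[OF T])
next
  case (pCons a p)
  have "T (opoly T p y) = opoly T p (T y)" for y
    using opoly_mult[OF T, of "[:0, 1:]" p y] opoly_mult[OF T, of p "[:0, 1:]" y]
    by (simp only: opoly_X[OF T] mult.commute)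
  then show ?case
    by (simp add: opoly_pCons[OF T] inner_simps sym pCons.IH)
qed

text \<open>The products \<open>X ^ k * (1 - X) ^ m\<close> are positive on a positive contraction. A square factor
  can be moved to both sides of the scalar product, which reduces everything to
  \<open>X * (1 - X) = X\<^sup>2 * (1 - X) + (1 - X)\<^sup>2 * X\<close>.\<close>

lemma opoly_bernstein_nonneg:
  fixes T :: "'a::real_inner \<Rightarrow> 'a"
  assumes T: "linear T" and sym: "\<And>x y. inner (T x) y = inner x (T y)"
    and pos: "\<And>x. 0 \<le> inner (T x) x" and le: "\<And>x. inner (T x) x \<le> inner x x"
  shows "0 \<le> inner (opoly T ([:0, 1:] ^ k * [:1, -1:] ^ m) x) x"
proof -
  let ?X = "[:0, 1:] :: real poly" and ?Y = "[:1, -1:] :: real poly"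
  define nonneg where "nonneg p \<longleftrightarrow> (\<forall>x. 0 \<le> inner (opoly T p x) x)" for p
  have sq: "nonneg (q * q * p)" if "nonneg p" for p q
  proof -
    have "opoly T (q * q * p) x = opoly T q (opoly T p (opoly T q x))" for x
      using opoly_mult[OF T, of q "p * q" x] opoly_mult[OF T, of p q x] by (simp add: mult_ac)
    then show ?thesis using that by (simp add: nonneg_def opoly_sym[OF T sym])
       (metis opoly_sym[OF T sym])
  qed
  have add: "nonneg p \<Longrightarrow> nonneg q \<Longrightarrow> nonneg (p + q)" for p q
    by (simp add: nonneg_def opoly_add[OF T] inner_add_left)
  have one: "nonneg 1" by (simp add: nonneg_def opoly_1[OF T])
  have X: "nonneg ?X" by (simp add: nonneg_def opoly_X[OF T] pos)
  have Y: "nonneg ?Y"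
    using le by (simp add: nonneg_def opoly_pCons[OF T] opoly_0[OF T] linear_0[OF T]
        linear_neg[OF T] inner_diff_left)
  have XY: "nonneg (?X * ?Y)"
  proof -
    have "?X * ?Y = ?X * ?X * ?Y + ?Y * ?Y * ?X" by simp
    then show ?thesis using add[OF sq[OF Y, of ?X] sq[OF X, of ?Y]] by simp
  qed
  have "nonneg (?X ^ k * ?Y ^ m)"
  proof (induction "k + m" arbitrary: k m rule: less_induct)
    case less
    consider "2 \<le> k" | "2 \<le> m" | "k < 2" "m < 2" by linarith
    then show ?case
    proof cases
      case 1
      then obtain l where l: "k = Suc (Suc l)" by (metis add_2_eq_Suc le_Suc_ex)
      have "nonneg (?X * ?X * (?X ^ l * ?Y ^ m))" by (rule sq, rule less) (simp add: l)
      moreover have "?X * ?X * (?X ^ l * ?Y ^ m) = ?X ^ k * ?Y ^ m"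
        by (simp only: l power_Suc mult_ac)
      ultimately show ?thesis by simp
    next
      case 2
      then obtain l where l: "m = Suc (Suc l)" by (metis add_2_eq_Suc le_Suc_ex)
      have "nonneg (?Y * ?Y * (?X ^ k * ?Y ^ l))" by (rule sq, rule less) (simp add: l)
      moreover have "?Y * ?Y * (?X ^ k * ?Y ^ l) = ?X ^ k * ?Y ^ m"
        by (simp only: l power_Suc mult_ac)
      ultimately show ?thesis by simp
    next
      case 3
      then have "k = 0 \<or> k = 1" "m = 0 \<or> m = 1" by auto
      then show ?thesis using one X Y XY by auto
    qed
  qed
  then show ?thesis by (simp add: nonneg_def)
qed

section \<open>The measure solving the moment problem of a positive contraction\<close>

text \<open>After \<open>(n choose k) * (k choose j) = (n choose j) * ((n - j) choose (k - j))\<close> the sum is the binomial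
  expansion of \<open>(X + (1 - X)) ^ (n - j)\<close>. So the factorial moments of the Bernstein weights are exact,
  not only asymptotic.\<close>

lemma bernstein_factorial_moment:
  "(\<Sum>k\<le>n. smult (real (n choose k) * real (k choose j)) ([:0, 1:] ^ k * [:1, -1:] ^ (n - k)))
    = smult (real (n choose j)) ([:0, 1:] ^ j)"
proof (cases "j \<le> n")
  case False
  then show ?thesis by (auto intro!: sum.neutral simp: binomial_eq_0)
next
  case True
  let ?X = "[:0, 1:] :: real poly" and ?Y = "[:1, -1:] :: real poly"
  let ?f = "\<lambda>k. smult (real (n choose k) * real (k choose j)) (?X ^ k * ?Y ^ (n - k))"
  have "(\<Sum>k\<le>n. ?f k) = (\<Sum>k\<in>{j..n}. ?f k)"
    by (rule sum.mono_neutral_right) (auto simp: binomial_eq_0)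
  also have "\<dots> = (\<Sum>i\<le>n - j. ?f (i + j))"
    using True sum.shift_bounds_cl_nat_ivl[of ?f 0 j "n - j"] by (simp add: atMost_atLeast0)
  also have "\<dots> = (\<Sum>i\<le>n - j. smult (real (n choose j)) (?X ^ j *
      (of_nat ((n - j) choose i) * ?X ^ i * ?Y ^ (n - j - i))))"
  proof (rule sum.cong[OF refl])
    fix i assume "i \<in> {..n - j}"
    then have "(n choose (i + j)) * ((i + j) choose j) = (n choose j) * ((n - j) choose i)"
      using choose_mult[of j "i + j" n] True by simp
    then have "real (n choose (i + j)) * real ((i + j) choose j)
        = real (n choose j) * real ((n - j) choose i)" by (metis of_nat_mult)
    then show "?f (i + j) = smult (real (n choose j)) (?X ^ j *
      (of_nat ((n - j) choose i) * ?X ^ i * ?Y ^ (n - j - i)))"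
      by (simp add: power_add of_nat_poly mult_ac add.commute[of i])
  qed
  also have "\<dots> = smult (real (n choose j)) (?X ^ j * (?X + ?Y) ^ (n - j))"
  proof -
    have "smult c (\<Sum>i\<in>A. f i) = (\<Sum>i\<in>A. smult c (f i))" for c and f :: "nat \<Rightarrow> real poly" and A
      by (induction A rule: infinite_finite_induct) (simp_all add: smult_add_right)
    then show ?thesis by (simp only: binomial_ring sum_distrib_left)
  qed
  also have "?X + ?Y = 1" by (simp add: one_pCons)
  finally show ?thesis by simp
qed

text \<open>The ratio of binomial coefficients gains the factor \<open>(k - j) / (n - j)\<close> when \<open>j\<close> grows by one, and this
  differs from \<open>k / n\<close> by at most \<open>j / (n - j)\<close>, whatever \<open>k\<close> is. Hence factorial moments and ordinary
  moments of distributions on the points \<open>k / n\<close> have the same limits.\<close>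

lemma binomial_ratio_uniform:
  "\<exists>\<epsilon>. \<epsilon> \<longlonglongrightarrow> 0 \<and> (\<forall>n\<ge>j. \<forall>k\<le>n.
     \<bar>(real k / real n) ^ j - real (k choose j) / real (n choose j)\<bar> \<le> \<epsilon> n)"
proof (induction j)
  case 0
  show ?case by (rule exI[of _ "\<lambda>_. 0"]) simp
next
  case (Suc j)
  then obtain \<epsilon> where e: "\<epsilon> \<longlonglongrightarrow> 0"
    and b: "\<And>n k. n \<ge> j \<Longrightarrow> k \<le> n \<Longrightarrow>
      \<bar>(real k / real n) ^ j - real (k choose j) / real (n choose j)\<bar> \<le> \<epsilon> n" by blast
  have rec: "real (l choose Suc j) = real (l choose j) * (real l - real j) / real (Suc j)" for l
    by (simp add: binomial_gbinomial gbinomial_prod_rev del: of_nat_Suc)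
  show ?case
  proof (intro exI conjI allI impI)
    have "filterlim (\<lambda>n. - real j + real n) at_top sequentially"
      by (rule filterlim_tendsto_add_at_top[OF tendsto_const filterlim_real_sequentially])
    then have "(\<lambda>n. real j / (- real j + real n)) \<longlonglongrightarrow> 0"
      by (intro tendsto_divide_0[OF tendsto_const] filterlim_at_top_imp_at_infinity)
    from tendsto_add[OF e this] show "(\<lambda>n. \<epsilon> n + real j / (- real j + real n)) \<longlonglongrightarrow> 0" by simp
  next
    fix n k assume n: "Suc j \<le> n" and k: "k \<le> n"
    define x where "x = real k / real n"
    define h where "h = real (k choose j) / real (n choose j)"
    define y where "y = (real k - real j) / (real n - real j)"
    have npos: "0 < real n" "0 < real n - real j" using n by auto
    have x01: "0 \<le> x" "x \<le> 1" using k npos by (auto simp: x_def)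
    have h01: "\<bar>h\<bar> \<le> 1"
      using binomial_right_mono[OF k, of j] n by (simp add: h_def divide_le_eq_1)
    have "real (k choose Suc j) / real (n choose Suc j) = h * y"
      unfolding rec h_def y_def by (simp add: divide_simps del: of_nat_Suc)
    moreover have "x - y = real j * (real n - real k) / (real n * (real n - real j))"
      using npos by (simp add: x_def y_def field_simps)
    moreover have "\<dots> \<le> real j / (real n - real j)"
      using npos k by (simp add: divide_simps) (simp add: algebra_simps mult_left_mono)
    moreover have "0 \<le> real j * (real n - real k) / (real n * (real n - real j))"
      using npos k by (intro divide_nonneg_nonneg mult_nonneg_nonneg) auto
    ultimately have xy: "\<bar>x - y\<bar> \<le> real j / (real n - real j)"
      and hy: "real (k choose Suc j) / real (n choose Suc j) = h * y" by linarith+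
    have "x ^ Suc j - h * y = (x ^ j - h) * x + h * (x - y)" by (simp add: algebra_simps)
    then have "\<bar>x ^ Suc j - h * y\<bar> \<le> \<bar>x ^ j - h\<bar> * x + \<bar>h\<bar> * \<bar>x - y\<bar>"
      using x01 by (metis abs_mult abs_of_nonneg abs_triangle_ineq)
    also have "\<dots> \<le> \<epsilon> n * 1 + 1 * (real j / (real n - real j))"
      using b[of n k] n k x01 h01 xy npos by (intro add_mono mult_mono) (auto simp: x_def h_def)
    finally show "\<bar>(real k / real n) ^ Suc j - real (k choose Suc j) / real (n choose Suc j)\<bar>
        \<le> \<epsilon> n + real j / (- real j + real n)"
      unfolding hy x_def[symmetric] by (simp add: minus_add_cancel)
  qed
qed

lemma finite_weights_distribution:
  fixes w :: "nat \<Rightarrow> real"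
  assumes w: "\<And>k. k \<le> n \<Longrightarrow> 0 \<le> w k" "(\<Sum>k\<le>n. w k) = 1"
  shows "\<exists>M. real_distribution M \<and> (AE t in M. t \<in> {0..1}) \<and>
      (\<forall>f. f \<in> borel_measurable borel \<longrightarrow> integral\<^sup>L M f = (\<Sum>k\<le>n. w k * f (real k / real n)))"
proof -
  define w' where "w' k = (if k \<le> n then w k else 0)" for k
  define Q where "Q = embed_pmf w'"
  have nn: "0 \<le> w' k" for k using w(1) by (simp add: w'_def)
  have "(\<integral>\<^sup>+k. ennreal (w' k) \<partial>count_space UNIV) = (\<Sum>k\<le>n. ennreal (w' k))"
    by (rule nn_integral_count_space') (auto simp: w'_def)
  also have "\<dots> = ennreal (\<Sum>k\<le>n. w' k)" by (rule sum_ennreal) (rule nn)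
  also have "(\<Sum>k\<le>n. w' k) = 1" using w(2) by (simp add: w'_def)
  also have "ennreal 1 = 1" by simp
  finally have Q: "pmf Q k = w' k" for k
    unfolding Q_def by (intro pmf_embed_pmf nn)
  have supp: "k \<le> n" if "k \<in> set_pmf Q" for k
    using that Q[of k] by (auto simp: set_pmf_eq w'_def split: if_splits)
  define M where "M = distr (measure_pmf Q) borel (\<lambda>k. real k / real n)"
  have "real_distribution M"
    unfolding M_def by (intro prob_space.real_distribution_distr measure_pmf.prob_space_axioms) simp
  moreover have "AE t in M. t \<in> {0..1}"
    unfolding M_def
    by (subst AE_distr_iff) (auto simp: AE_measure_pmf_iff divide_le_eq_1 dest: supp)
  moreover have "integral\<^sup>L M f = (\<Sum>k\<le>n. w k * f (real k / real n))"
    if "f \<in> borel_measurable borel" for f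
  proof -
    have "integral\<^sup>L M f = (\<integral>k. f (real k / real n) \<partial>measure_pmf Q)"
      unfolding M_def using that by (intro integral_distr) auto
    also have "\<dots> = (\<Sum>k\<le>n. f (real k / real n) * pmf Q k)"
      by (rule integral_measure_pmf_real) (auto dest: supp)
    also have "\<dots> = (\<Sum>k\<le>n. w k * f (real k / real n))"
      by (rule sum.cong) (auto simp: Q w'_def)
    finally show ?thesis .
  qed
  ultimately show ?thesis by blast
qed

text \<open>Hausdorff's solution of the moment problem: the Bernstein weights are probability
  distributions on the points \<open>k / n\<close>, their factorial moments are exactly those of the operator,
  and Helly's selection theorem gives a weak limit.\<close>

lemma moment_distribution_unit:
  fixes T :: "'a::real_inner \<Rightarrow> 'a"
  assumes T: "linear T" and sym: "\<And>x y. inner (T x) y = inner x (T y)"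
    and pos: "\<And>x. 0 \<le> inner (T x) x" and le: "\<And>x. inner (T x) x \<le> inner x x"
    and x: "norm x = 1"
  shows "\<exists>M. real_distribution M \<and> (AE t in M. t \<in> {0..1}) \<and>
      (\<forall>p. (\<integral>t. poly p (clip t) \<partial>M) = inner (opoly T p x) x)"
proof -
  let ?X = "[:0, 1:] :: real poly" and ?Y = "[:1, -1:] :: real poly"
  define w where "w n k = real (n choose k) * inner (opoly T (?X ^ k * ?Y ^ (n - k)) x) x" for n k
  have w0: "0 \<le> w n k" for n k
    using opoly_bernstein_nonneg[OF T sym pos le] by (simp add: w_def)
  have wj: "(\<Sum>k\<le>n. w n k * real (k choose j)) = real (n choose j) * inner (opoly T (?X ^ j) x) x"
    for n j
  proof -
    have "(\<Sum>k\<le>n. w n k * real (k choose j)) = inner (opoly T (\<Sum>k\<le>n.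
        smult (real (n choose k) * real (k choose j)) (?X ^ k * ?Y ^ (n - k))) x) x"
      by (simp add: opoly_sum[OF T] opoly_smult[OF T] inner_sum_left w_def mult_ac)
    then show ?thesis by (simp add: bernstein_factorial_moment opoly_smult[OF T])
  qed
  have w1: "(\<Sum>k\<le>n. w n k) = 1" for n
    using wj[of n 0] x by (simp add: opoly_1[OF T] dot_square_norm)
  obtain N where N: "\<And>n. real_distribution (N n)" "\<And>n. AE t in N n. t \<in> {0..1}"
    and Nint: "\<And>n f. f \<in> borel_measurable borel \<Longrightarrow>
      integral\<^sup>L (N n) f = (\<Sum>k\<le>n. w n k * f (real k / real n))"
    using finite_weights_distribution[OF w0 w1] by metis
  have clip_frac: "clip (real k / real n) = real k / real n" if "k \<le> n" for k n
    using that by (intro clip_id) (auto simp: divide_le_eq_1)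
  have "tight N"
    unfolding tight_def
  proof (intro conjI allI impI N)
    fix \<epsilon> :: real assume "\<epsilon> > 0"
    have "measure (N n) {-1<..1} = 1" for n
    proof -
      interpret real_distribution "N n" by (rule N)
      show ?thesis using N(2)[of n] by (subst prob_eq_1) (auto elim: eventually_mono)
    qed
    then show "\<exists>a b. a < b \<and> (\<forall>n. 1 - \<epsilon> < measure (N n) {a<..b})"
      using \<open>\<epsilon> > 0\<close> by (intro exI[of _ "-1"] exI[of _ 1]) simp
  qed
  from tight_imp_convergent_subsubsequence[OF this, of id]
  obtain r M where r: "strict_mono r" and M: "real_distribution M" "weak_conv_m (N \<circ> r) M"
    by (auto simp: strict_mono_def)
  have conv: "(\<lambda>n. integral\<^sup>L (N (r n)) f) \<longlonglongrightarrow> integral\<^sup>L M f"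
    if "continuous_on UNIV f" "\<And>t. \<bar>f t\<bar> \<le> B" for f :: "real \<Rightarrow> real" and B
    using weak_conv_imp_integral_bdd_continuous_conv[of "N \<circ> r" M f B] N(1) M that
    by (simp add: continuous_on_eq_continuous_at)
  interpret M: real_distribution M by (rule M(1))
  have AEM: "AE t in M. t \<in> {0..1}"
  proof -
    \<comment> \<open>The limit stays on the interval: the truncated distance to it is bounded and continuous.\<close>
    let ?f = "\<lambda>t. min 1 \<bar>t - clip t\<bar>"
    have c: "continuous_on UNIV ?f" by (intro continuous_intros continuous_on_clip)
    have m: "?f \<in> borel_measurable borel" by (rule borel_measurable_continuous_onI[OF c])
    have "integral\<^sup>L (N n) ?f = 0" for n
    proof -
      have "integral\<^sup>L (N n) ?f = (\<Sum>k\<le>n. w n k * 0)"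
        unfolding Nint[OF m]
        by (intro sum.cong refl arg_cong2[where f = "(*)"]) (auto simp: clip_frac)
      then show ?thesis by simp
    qed
    then have "integral\<^sup>L M ?f = 0"
      using conv[OF c, of 1] by (simp add: LIMSEQ_const_iff abs_le_iff)
    moreover have "integrable M ?f"
      using m by (intro M.integrable_const_bound[where B = 1]) auto
    ultimately have "AE t in M. ?f t = 0"
      by (subst (asm) integral_nonneg_eq_0_iff_AE) auto
    then show ?thesis
    proof (rule eventually_mono)
      fix t assume "?f t = 0"
      then have "t = clip t" by (auto simp: min_def split: if_splits)
      then show "t \<in> {0..1}" using clip_mem[of t] by simp
    qed
  qed
  have moment: "(\<integral>t. clip t ^ j \<partial>M) = inner (opoly T (?X ^ j) x) x" for j
  proof -
    let ?s = "inner (opoly T (?X ^ j) x) x"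
    have c: "continuous_on UNIV (\<lambda>t. clip t ^ j)" by (intro continuous_intros continuous_on_clip)
    have cb: "\<bar>clip t ^ j\<bar> \<le> 1" for t using clip_mem[of t] by (simp add: power_le_one)
    have m: "(\<lambda>t. clip t ^ j) \<in> borel_measurable borel" by (rule borel_measurable_continuous_onI[OF c])
    obtain \<epsilon> where e: "\<epsilon> \<longlonglongrightarrow> 0" and eb: "\<And>n k. n \<ge> j \<Longrightarrow> k \<le> n \<Longrightarrow>
      \<bar>(real k / real n) ^ j - real (k choose j) / real (n choose j)\<bar> \<le> \<epsilon> n"
      using binomial_ratio_uniform[of j] by blast
    have "\<bar>(\<integral>t. clip t ^ j \<partial>N n) - ?s\<bar> \<le> \<epsilon> n" if n: "n \<ge> j" for n
    proof -
      have "?s = (\<Sum>k\<le>n. w n k * (real (k choose j) / real (n choose j)))"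
        using wj[of n j] n by (simp add: sum_divide_distrib[symmetric] field_simps)
      moreover have "(\<integral>t. clip t ^ j \<partial>N n) = (\<Sum>k\<le>n. w n k * (real k / real n) ^ j)"
        unfolding Nint[OF m]
        by (intro sum.cong refl arg_cong2[where f = "(*)"]) (auto simp: clip_frac)
      ultimately have "(\<integral>t. clip t ^ j \<partial>N n) - ?s =
          (\<Sum>k\<le>n. w n k * ((real k / real n) ^ j - real (k choose j) / real (n choose j)))"
        by (simp add: sum_subtractf right_diff_distrib)
      also have "\<bar>\<dots>\<bar> \<le> (\<Sum>k\<le>n. w n k * \<epsilon> n)"
      proof (rule order_trans[OF sum_abs], rule sum_mono)
        fix k assume "k \<in> {..n}"
        then show "\<bar>w n k * ((real k / real n) ^ j - real (k choose j) / real (n choose j))\<bar>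
            \<le> w n k * \<epsilon> n"
          using eb[OF n, of k] w0[of n k] by (simp add: abs_mult mult_left_mono)
      qed
      also have "\<dots> = \<epsilon> n" using w1[of n] by (simp add: sum_distrib_right[symmetric])
      finally show ?thesis .
    qed
    then have ev: "\<forall>\<^sub>F n in sequentially. norm ((\<integral>t. clip t ^ j \<partial>N n) - ?s) \<le> \<epsilon> n"
      by (auto simp: eventually_sequentially)
    have "(\<lambda>n. \<integral>t. clip t ^ j \<partial>N n) \<longlonglongrightarrow> ?s"
      by (rule LIM_zero_cancel, rule Lim_null_comparison[OF ev e])
    from LIMSEQ_subseq_LIMSEQ[OF this r] conv[OF c cb] show ?thesis
      by (intro LIMSEQ_unique) (auto simp: comp_def)
  qed
  have "(\<integral>t. poly p (clip t) \<partial>M) = inner (opoly T p x) x" for p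
  proof -
    have int: "integrable M (\<lambda>t. clip t ^ i)" for i
    proof (rule M.integrable_const_bound[where B = 1])
      show "AE t in M. norm (clip t ^ i) \<le> 1"
        using clip_mem by (auto simp: power_le_one intro!: AE_I2)
      have "continuous_on UNIV (\<lambda>t. clip t ^ i)" by (intro continuous_intros continuous_on_clip)
      then show "(\<lambda>t. clip t ^ i) \<in> borel_measurable M"
        using borel_measurable_continuous_onI[of "\<lambda>t. clip t ^ i"] by simp
    qed
    show ?thesis
      unfolding poly_altdef opoly_altdef[OF T, of p]
      by (simp add: int inner_sum_left moment)
  qed
  with M(1) AEM show ?thesis by blast
qed

text \<open>For \<open>x = 0\<close> any distribution on \<open>{0..1}\<close> serves, because the factor \<open>(norm x)\<^sup>2\<close> vanishes; otherwise \<open>x\<close>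
  is normalized.\<close>

lemma moment_distribution:
  fixes T :: "'a::real_inner \<Rightarrow> 'a"
  assumes T: "linear T" and sym: "\<And>x y. inner (T x) y = inner x (T y)"
    and pos: "\<And>x. 0 \<le> inner (T x) x" and le: "\<And>x. inner (T x) x \<le> inner x x"
  shows "\<exists>M. real_distribution M \<and> (AE t in M. t \<in> {0..1}) \<and>
      (\<forall>p. (norm x)\<^sup>2 * (\<integral>t. poly p (clip t) \<partial>M) = inner (opoly T p x) x)"
proof (cases "x = 0")
  case True
  have "real_distribution (return borel 0)"
    by (simp add: real_distribution_def real_distribution_axioms_def prob_space_return)
  moreover have "AE t in return borel (0::real). t \<in> {0..1}" by (subst AE_return) auto
  ultimately show ?thesis using True by (intro exI[of _ "return borel 0"]) simp
next
  case False
  define u where "u = (1 / norm x) *\<^sub>R x"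
  have u: "norm u = 1" "x = norm x *\<^sub>R u" using False by (simp_all add: u_def)
  obtain M where M: "real_distribution M" "AE t in M. t \<in> {0..1}"
    "\<And>p. (\<integral>t. poly p (clip t) \<partial>M) = inner (opoly T p u) u"
    using moment_distribution_unit[OF T sym pos le u(1)] by blast
  have "(norm x)\<^sup>2 * inner (opoly T p u) u = inner (opoly T p x) x" for p
  proof -
    have "inner (opoly T p (norm x *\<^sub>R u)) (norm x *\<^sub>R u) = (norm x)\<^sup>2 * inner (opoly T p u) u"
      by (simp add: opoly_scale_arg[OF T] power2_eq_square)
    then show ?thesis using u(2) by simp
  qed
  with M show ?thesis by auto
qed

lemma positive_contraction_calculus:
  fixes T :: "'a::{real_inner, complete_space} \<Rightarrow> 'a"
  assumes T: "linear T" and sym: "\<And>x y. inner (T x) y = inner x (T y)"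
    and pos: "\<And>x. 0 \<le> inner (T x) x" and le: "\<And>x. inner (T x) x \<le> inner x x"
  shows "\<exists>J. calculus_seed {0..1} J UNIV (\<lambda>p t. poly p (clip t)) (opoly T) (*)"
proof -
  have "\<forall>x. \<exists>M. real_distribution M \<and> (AE t in M. t \<in> {0..1}) \<and>
      (\<forall>p. (norm x)\<^sup>2 * (\<integral>t. poly p (clip t) \<partial>M) = inner (opoly T p x) x)"
    using moment_distribution[OF T sym pos le] by blast
  then obtain M where M: "\<And>x. real_distribution (M x)" "\<And>x. AE t in M x. t \<in> {0..1}"
    "\<And>x p. (norm x)\<^sup>2 * (\<integral>t. poly p (clip t) \<partial>M x) = inner (opoly T p x) x" by metis
  define J where "J x g = (norm x)\<^sup>2 * integral\<^sup>L (M x) g" for x g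
  have "calculus_seed {0..1} J UNIV (\<lambda>p t. poly p (clip t)) (opoly T) (*)"
  proof
    fix x :: 'a
    interpret real_distribution "M x" by (rule M)
    show "sigma_functional {0..1} (J x)"
      unfolding J_def[abs_def]
      by (intro sigma_functional_scale sigma_functional_integral M(2) events_eq_borel
          finite_measure_axioms)
    fix g :: "real \<Rightarrow> real" and K
    assume g: "bounded_borel g" and K: "\<And>t. t \<in> {0..1} \<Longrightarrow> \<bar>g t\<bar> \<le> K"
    have AE: "AE t in M x. \<bar>g t\<bar> \<le> K" using M(2)[of x] by (rule eventually_mono) (rule K)
    have int: "integrable (M x) g"
      using AE bounded_borel_measurable[OF g] by (intro integrable_const_bound[where B = K]) auto
    have "integral\<^sup>L (M x) g \<le> K"
      by (rule integral_le_const[OF int]) (use AE in \<open>auto elim: eventually_mono\<close>)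
    moreover have "- K \<le> integral\<^sup>L (M x) g"
      by (rule integral_ge_const[OF int]) (use AE in \<open>auto elim: eventually_mono\<close>)
    ultimately have "\<bar>integral\<^sup>L (M x) g\<bar> \<le> K" by linarith
    then show "\<bar>J x g\<bar> \<le> K * (norm x)\<^sup>2"
      unfolding J_def by (simp add: abs_mult mult.commute[of K] mult_left_mono)
  next
    show "bounded_borel (\<lambda>t. poly p (clip t))" for p
      by (intro bounded_borel_continuous_clip continuous_intros)
    show "J x (\<lambda>t. poly p (clip t)) = inner (opoly T p x) x" for p x
      by (simp add: J_def M(3))
    show "L g = 0" if "sigma_functional {0..1} L" "\<And>p. p \<in> UNIV \<Longrightarrow> L (\<lambda>t. poly p (clip t)) = 0"
      "bounded_borel g" for L g
      using sigma_functional_eq_0_of_polys[OF that(1) _ that(3)] that(2) by blast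
  qed (simp_all add: opoly_mult[OF T] opoly_add_arg[OF T] opoly_scale_arg[OF T] opoly_sym[OF T sym])
  then show ?thesis by blast
qed

section \<open>Unbounded spectral integrals\<close>

lemma spectral_scalar_measure:
  assumes E: "projection_valued_measure E"
  shows "sets (spectral_scalar_measure E x) = sets borel"
    and "space (spectral_scalar_measure E x) = UNIV"
    and "B \<in> sets borel \<Longrightarrow> emeasure (spectral_scalar_measure E x) B = ennreal (inner (E B x) x)"
    and "B \<in> sets borel \<Longrightarrow> 0 \<le> inner (E B x) x"
    and "finite_measure (spectral_scalar_measure E x)"
    and "B \<in> sets borel \<Longrightarrow> measure (spectral_scalar_measure E x) B = inner (E B x) x"
proof -
  have pos: "0 \<le> inner (E B x) x" if B: "B \<in> sets borel" for B
  proof -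
    have "inner (E B x) x = inner (E B (E B x)) x"
      using E B unfolding projection_valued_measure_def by metis
    also have "\<dots> = inner (E B x) (E B x)"
      using E B unfolding projection_valued_measure_def by metis
    finally show ?thesis by simp
  qed
  then show "0 \<le> inner (E B x) x" if "B \<in> sets borel" using that .
  show s: "sets (spectral_scalar_measure E x) = sets borel"
    unfolding spectral_scalar_measure_def
    using sets.sigma_sets_eq[of "borel :: real measure"] by (simp add: sets_measure_of)
  show sp: "space (spectral_scalar_measure E x) = UNIV"
    unfolding spectral_scalar_measure_def by (simp add: space_measure_of)
  have em: "emeasure (spectral_scalar_measure E x) B = ennreal (inner (E B x) x)"
    if B: "B \<in> sets borel" for B
  proof (rule emeasure_measure_of[OF spectral_scalar_measure_def])
    show "positive (sets (spectral_scalar_measure E x)) (\<lambda>B. ennreal (inner (E B x) x))"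
      using E by (simp add: positive_def projection_valued_measure_def)
    show "countably_additive (sets (spectral_scalar_measure E x)) (\<lambda>B. ennreal (inner (E B x) x))"
      unfolding s
    proof (rule countably_additiveI)
      fix F :: "nat \<Rightarrow> real set"
      assume F: "range F \<subseteq> sets borel" "disjoint_family F"
      then have "(\<lambda>n. E (F n) x) sums E (\<Union>n. F n) x"
        using E unfolding projection_valued_measure_def by blast
      then have "(\<lambda>n. inner (E (F n) x) x) sums inner (E (\<Union>n. F n) x) x"
        by (rule bounded_linear.sums[OF bounded_linear_inner_left])
      then show "(\<Sum>n. ennreal (inner (E (F n) x) x)) = ennreal (inner (E (\<Union>n. F n) x) x)"
        using F(1) by (intro suminf_ennreal_eq pos) auto
    qed
  qed (use B s in auto)
  then show "emeasure (spectral_scalar_measure E x) B = ennreal (inner (E B x) x)"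
    if "B \<in> sets borel" using that .
  show "finite_measure (spectral_scalar_measure E x)"
    by (rule finite_measureI) (simp add: em sp)
  show "measure (spectral_scalar_measure E x) B = inner (E B x) x" if "B \<in> sets borel"
    using em[OF that] pos[OF that] by (simp add: measure_def)
qed

text \<open>An arbitrary spectral measure, carried by \<open>S\<close>. The calculus of the previous part applies to it with
  the indicators of Borel sets as generating class.\<close>

locale spectral_family =
  fixes E :: "real set \<Rightarrow> 'a::{real_inner, complete_space} \<Rightarrow> 'a" and S :: "real set"
  assumes pvm: "projection_valued_measure E"
    and S_borel: "S \<in> sets borel" and E_S: "\<And>x. E S x = x"
begin

abbreviation \<mu> :: "'a \<Rightarrow> real measure" where "\<mu> x \<equiv> spectral_scalar_measure E x"

lemma sets_mu[simp, measurable_cong]: "sets (\<mu> x) = sets borel"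
  and space_mu[simp]: "space (\<mu> x) = UNIV"
  and finite_measure_mu: "finite_measure (\<mu> x)"
  and measure_mu: "B \<in> sets borel \<Longrightarrow> measure (\<mu> x) B = inner (E B x) x"
  by (rule spectral_scalar_measure[OF pvm]; assumption)+

lemma E_UNIV: "E UNIV x = x" and E_Int: "B \<in> sets borel \<Longrightarrow> C \<in> sets borel \<Longrightarrow> E (B \<inter> C) x = E B (E C x)"
  and E_sym: "B \<in> sets borel \<Longrightarrow> inner (E B x) y = inner x (E B y)"
  and E_linear: "B \<in> sets borel \<Longrightarrow> bounded_linear (E B)"
  using pvm unfolding projection_valued_measure_def by auto

lemma measure_mu_UNIV: "measure (\<mu> x) UNIV = (norm x)\<^sup>2"
  by (simp add: measure_mu E_UNIV power2_norm_eq_inner)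

lemma AE_mu: "AE t in \<mu> x. t \<in> S"
proof -
  interpret finite_measure "\<mu> x" by (rule finite_measure_mu)
  have "measure (\<mu> x) (UNIV - S) = 0"
    using finite_measure_compl[of S] S_borel by (simp add: measure_mu E_S E_UNIV)
  then have "emeasure (\<mu> x) (UNIV - S) = 0" by (simp add: emeasure_eq_measure)
  then show ?thesis using S_borel by (intro AE_I[where N = "UNIV - S"]) auto
qed

lemma integrable_mu: "bounded_borel g \<Longrightarrow> integrable (\<mu> x) g"
proof -
  assume g: "bounded_borel g"
  interpret finite_measure "\<mu> x" by (rule finite_measure_mu)
  obtain K where "\<And>t. \<bar>g t\<bar> \<le> K" using g bounded_borelE by blast
  then show "integrable (\<mu> x) g"
    using bounded_borel_measurable[OF g] by (intro integrable_const_bound[where B = K]) auto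
qed

lemma integral_mu_bound:
  assumes g: "bounded_borel g" and K: "\<And>t. t \<in> S \<Longrightarrow> \<bar>g t\<bar> \<le> K"
  shows "\<bar>integral\<^sup>L (\<mu> x) g\<bar> \<le> K * (norm x)\<^sup>2"
proof -
  interpret finite_measure "\<mu> x" by (rule finite_measure_mu)
  have AE: "AE t in \<mu> x. \<bar>g t\<bar> \<le> K" using AE_mu by (rule eventually_mono) (rule K)
  have "\<bar>integral\<^sup>L (\<mu> x) g\<bar> \<le> (\<integral>t. \<bar>g t\<bar> \<partial>\<mu> x)" by (rule integral_abs_bound)
  also have "\<dots> \<le> (\<integral>t. K \<partial>\<mu> x)"
    using AE integrable_mu[OF g] by (intro integral_mono_AE) auto
  also have "\<dots> = K * (norm x)\<^sup>2" by (simp add: measure_mu_UNIV mult.commute)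
  finally show ?thesis .
qed

sublocale calculus_seed S "\<lambda>x. integral\<^sup>L (\<mu> x)" "sets borel" indicator E "(\<inter>)"
proof
  show "sigma_functional S (integral\<^sup>L (\<mu> x))" for x
    using sigma_functional_integral[OF finite_measure_mu sets_mu AE_mu] .
  show "\<bar>integral\<^sup>L (\<mu> x) g\<bar> \<le> K * (norm x)\<^sup>2"
    if "bounded_borel g" "\<And>t. t \<in> S \<Longrightarrow> \<bar>g t\<bar> \<le> K" for x g K
    by (rule integral_mu_bound[OF that])
  show "integral\<^sup>L (\<mu> x) (indicator B) = inner (E B x) x" if "B \<in> sets borel" for x B
    using that by (simp add: measure_mu)
  show "L g = 0" if "sigma_functional S L" "\<And>B. B \<in> sets borel \<Longrightarrow> L (indicator B) = 0"
    "bounded_borel g" for L g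
    using sigma_functional_eq_0_of_indicators[OF that] .
  show "E B (x + y) = E B x + E B y" if "B \<in> sets borel" for B x y
    using E_linear[OF that] by (simp add: linear_simps)
  show "E B (r *\<^sub>R x) = r *\<^sub>R E B x" if "B \<in> sets borel" for B r x
    using E_linear[OF that] by (simp add: linear_simps)
qed (simp_all add: bounded_borel_indicator indicator_inter_arith E_Int E_sym)

lemma integral_Phi:
  assumes g: "bounded_borel g" and h: "bounded_borel h"
  shows "integral\<^sup>L (\<mu> (Phi h x)) g = (\<integral>t. g t * (h t)\<^sup>2 \<partial>\<mu> x)"
proof -
  have "integral\<^sup>L (\<mu> (Phi h x)) g = inner (Phi h (Phi g (Phi h x))) x"
    by (simp add: I_diag[OF g, symmetric] inner_Phi[OF g, symmetric] Phi_sym[OF h])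
  also have "\<dots> = inner (Phi (\<lambda>t. h t * (g t * h t)) x) x"
    by (simp add: Phi_mult g h bounded_borel_mult)
  also have "\<dots> = (\<integral>t. h t * (g t * h t) \<partial>\<mu> x)"
    by (simp add: inner_Phi I_diag g h bounded_borel_mult)
  finally show ?thesis by (simp add: power2_eq_square mult_ac)
qed

abbreviation domain where "domain f \<equiv> spectral_integral_domain E f"

text \<open>Square integrability tested by bounded functions only, so that the bounded calculus can decide
  membership in the domain.\<close>

lemma domain_iff:
  assumes f: "f \<in> borel_measurable borel"
  shows "x \<in> domain f \<longleftrightarrow> (\<exists>C. \<forall>n. (\<integral>t. min ((f t)\<^sup>2) (real n) \<partial>\<mu> x) \<le> C)"
proof -
  have fm: "(\<lambda>t. (f t)\<^sup>2) \<in> borel_measurable (\<mu> x)" using f by simp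
  have bb: "bounded_borel (\<lambda>t. min ((f t)\<^sup>2) (real n))" for n
    using f by (intro bounded_borelI[of _ "real n"]) auto
  show ?thesis
  proof
    assume "x \<in> domain f"
    then have int: "integrable (\<mu> x) (\<lambda>t. (f t)\<^sup>2)" by (simp add: spectral_integral_domain_def)
    have "(\<integral>t. min ((f t)\<^sup>2) (real n) \<partial>\<mu> x) \<le> (\<integral>t. (f t)\<^sup>2 \<partial>\<mu> x)" for n
      by (intro integral_mono integrable_mu bb int) simp
    then show "\<exists>C. \<forall>n. (\<integral>t. min ((f t)\<^sup>2) (real n) \<partial>\<mu> x) \<le> C" by blast
  next
    assume "\<exists>C. \<forall>n. (\<integral>t. min ((f t)\<^sup>2) (real n) \<partial>\<mu> x) \<le> C"
    then obtain C where C: "\<And>n. (\<integral>t. min ((f t)\<^sup>2) (real n) \<partial>\<mu> x) \<le> C" by blast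
    have "incseq (\<lambda>n. \<integral>t. min ((f t)\<^sup>2) (real n) \<partial>\<mu> x)"
      by (intro incseq_SucI integral_mono integrable_mu bb) auto
    then obtain l where l: "(\<lambda>n. \<integral>t. min ((f t)\<^sup>2) (real n) \<partial>\<mu> x) \<longlonglongrightarrow> l"
      using incseq_convergent C by blast
    have "integrable (\<mu> x) (\<lambda>t. (f t)\<^sup>2)"
    proof (rule integrable_monotone_convergence[OF integrable_mu[OF bb] _ _ l fm])
      show "AE t in \<mu> x. mono (\<lambda>n. min ((f t)\<^sup>2) (real n))" by (auto simp: mono_def)
      show "AE t in \<mu> x. (\<lambda>n. min ((f t)\<^sup>2) (real n)) \<longlonglongrightarrow> (f t)\<^sup>2"
      proof (rule AE_I2)
        fix t
        obtain N where "(f t)\<^sup>2 \<le> real N" using real_arch_simple by blast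
        then have "\<forall>n\<ge>N. min ((f t)\<^sup>2) (real n) = (f t)\<^sup>2" by (auto simp: min_def)
        then show "(\<lambda>n. min ((f t)\<^sup>2) (real n)) \<longlonglongrightarrow> (f t)\<^sup>2"
          by (intro tendsto_eventually) (auto simp: eventually_sequentially)
      qed
    qed
    then show "x \<in> domain f" by (simp add: spectral_integral_domain_def)
  qed
qed

text \<open>This is the parallelogram law for the measures, \<open>\<mu> (x + z) + \<mu> (x - z) = 2 \<mu> x + 2 \<mu> z\<close>. It makes the
  domain of an unbounded integral a linear subspace.\<close>

lemma integral_mu_add_le:
  assumes g: "bounded_borel g" and g0: "\<And>t. 0 \<le> g t"
  shows "integral\<^sup>L (\<mu> (x + z)) g \<le> 2 * integral\<^sup>L (\<mu> x) g + 2 * integral\<^sup>L (\<mu> z) g"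
    and "integral\<^sup>L (\<mu> (x - z)) g \<le> 2 * integral\<^sup>L (\<mu> x) g + 2 * integral\<^sup>L (\<mu> z) g"
proof -
  have "integral\<^sup>L (\<mu> (x + z)) g = I x (x + z) g + I z (x + z) g"
    by (simp add: I_diag[OF g, symmetric] I_add[OF g])
  also have "I x (x + z) g = I x x g + I x z g"
    using I_add[OF g, of x z x] I_sym[OF g, of x "x + z"] I_sym[OF g, of z x] by linarith
  also have "I z (x + z) g = I x z g + I z z g"
    using I_add[OF g, of x z z] I_sym[OF g, of z "x + z"] by linarith
  finally have p: "integral\<^sup>L (\<mu> (x + z)) g = integral\<^sup>L (\<mu> x) g + 2 * I x z g + integral\<^sup>L (\<mu> z) g"
    by (simp add: I_diag[OF g])
  moreover have "4 * I x z g = integral\<^sup>L (\<mu> (x + z)) g - integral\<^sup>L (\<mu> (x - z)) g"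
    by (simp add: I_def)
  moreover have "0 \<le> integral\<^sup>L (\<mu> (x + z)) g" "0 \<le> integral\<^sup>L (\<mu> (x - z)) g"
    using g0 by (auto intro!: integral_nonneg_AE)
  ultimately show "integral\<^sup>L (\<mu> (x + z)) g \<le> 2 * integral\<^sup>L (\<mu> x) g + 2 * integral\<^sup>L (\<mu> z) g"
    and "integral\<^sup>L (\<mu> (x - z)) g \<le> 2 * integral\<^sup>L (\<mu> x) g + 2 * integral\<^sup>L (\<mu> z) g"
    by linarith+
qed

lemma domain_add_diff:
  assumes f: "f \<in> borel_measurable borel" and x: "x \<in> domain f" and z: "z \<in> domain f"
  shows "x + z \<in> domain f" and "x - z \<in> domain f"
proof -
  obtain C where C: "\<And>n. (\<integral>t. min ((f t)\<^sup>2) (real n) \<partial>\<mu> x) \<le> C" using x domain_iff[OF f] by blast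
  obtain C' where C': "\<And>n. (\<integral>t. min ((f t)\<^sup>2) (real n) \<partial>\<mu> z) \<le> C'" using z domain_iff[OF f] by blast
  have bb: "bounded_borel (\<lambda>t. min ((f t)\<^sup>2) (real n))" for n
    using f by (intro bounded_borelI[of _ "real n"]) auto
  have "(\<integral>t. min ((f t)\<^sup>2) (real n) \<partial>\<mu> (x + z)) \<le> 2 * C + 2 * C'" for n
    using integral_mu_add_le(1)[OF bb, of n x z] C[of n] C'[of n] by simp
  then show "x + z \<in> domain f" using domain_iff[OF f] by blast
  have "(\<integral>t. min ((f t)\<^sup>2) (real n) \<partial>\<mu> (x - z)) \<le> 2 * C + 2 * C'" for n
    using integral_mu_add_le(2)[OF bb, of n x z] C[of n] C'[of n] by simp
  then show "x - z \<in> domain f" using domain_iff[OF f] by blast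
qed

lemma integrable_of_domain:
  assumes f: "f \<in> borel_measurable borel" and x: "x \<in> domain f"
  shows "integrable (\<mu> x) f"
proof -
  have "integrable (\<mu> x) (\<lambda>t. 1 + (f t)\<^sup>2)"
    using x integrable_mu[OF bounded_borel_const] by (auto simp: spectral_integral_domain_def)
  then show ?thesis
  proof (rule Bochner_Integration.integrable_bound)
    show "f \<in> borel_measurable (\<mu> x)" using f by simp
    show "AE t in \<mu> x. norm (f t) \<le> norm (1 + (f t)\<^sup>2)"
    proof (rule AE_I2)
      fix t
      have "0 \<le> (\<bar>f t\<bar> - 1)\<^sup>2" by simp
      then have "2 * \<bar>f t\<bar> \<le> 1 + (f t)\<^sup>2" by (simp add: power2_diff)
      then show "norm (f t) \<le> norm (1 + (f t)\<^sup>2)" by simp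
    qed
  qed
qed

definition trunc :: "(real \<Rightarrow> real) \<Rightarrow> nat \<Rightarrow> real \<Rightarrow> real" where
  "trunc f n t = f t * indicator {t. \<bar>f t\<bar> \<le> real n} t"

lemma trunc_bb: "f \<in> borel_measurable borel \<Longrightarrow> bounded_borel (trunc f n)"
  unfolding trunc_def[abs_def]
  by (intro bounded_borelI[of _ "real n"]) (auto simp: indicator_def)

lemma trunc_tendsto: "(\<lambda>n. trunc f n t) \<longlonglongrightarrow> f t"
proof -
  obtain N where "\<bar>f t\<bar> \<le> real N" using real_arch_simple by blast
  then have "\<forall>n\<ge>N. trunc f n t = f t" by (auto simp: trunc_def indicator_def)
  then show ?thesis by (intro tendsto_eventually) (auto simp: eventually_sequentially)
qed

lemma abs_trunc_le: "\<bar>trunc f n t\<bar> \<le> \<bar>f t\<bar>"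
  by (simp add: trunc_def indicator_def)

text \<open>The domain is dense, because it contains the vectors \<open>E {t. \<bar>f t\<bar> \<le> n} d\<close>.\<close>

lemma eq_0_of_orthogonal_domain:
  assumes f: "f \<in> borel_measurable borel" and d: "\<And>z. z \<in> domain f \<Longrightarrow> inner d z = 0"
  shows "d = 0"
proof -
  define h where "h n = (indicator {t. \<bar>f t\<bar> \<le> real n} :: real \<Rightarrow> real)" for n
  have B: "{t. \<bar>f t\<bar> \<le> real n} \<in> sets borel" for n using f by simp
  have hb: "bounded_borel (h n)" for n unfolding h_def by (rule bounded_borel_indicator[OF B])
  have "Phi (h n) d = 0" for n
  proof -
    have "(\<integral>t. min ((f t)\<^sup>2) (real k) \<partial>\<mu> (Phi (h n) d)) \<le> (real n)\<^sup>2 * (norm d)\<^sup>2" for k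
    proof -
      have bb: "bounded_borel (\<lambda>t. min ((f t)\<^sup>2) (real k))"
        using f by (intro bounded_borelI[of _ "real k"]) auto
      have "\<bar>min ((f t)\<^sup>2) (real k) * (h n t)\<^sup>2\<bar> \<le> (real n)\<^sup>2" for t
        using power_mono[of "\<bar>f t\<bar>" "real n" 2] by (auto simp: h_def indicator_def)
      then have "\<bar>\<integral>t. min ((f t)\<^sup>2) (real k) * (h n t)\<^sup>2 \<partial>\<mu> d\<bar> \<le> (real n)\<^sup>2 * (norm d)\<^sup>2"
        by (intro integral_mu_bound bounded_borel_mult bb bounded_borel_power2 hb)
      then show ?thesis by (simp add: integral_Phi[OF bb hb])
    qed
    then have "Phi (h n) d \<in> domain f" using domain_iff[OF f] by blast
    then have "inner d (Phi (h n) d) = 0" by (rule d)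
    moreover have "inner d (Phi (h n) d) = inner (Phi (h n) d) (Phi (h n) d)"
    proof -
      have "(\<lambda>t. h n t * h n t) = h n" by (auto simp: h_def indicator_def)
      then have "Phi (h n) d = Phi (h n) (Phi (h n) d)" using Phi_mult[OF hb hb, of n n d] by simp
      then have "inner d (Phi (h n) d) = inner d (Phi (h n) (Phi (h n) d))" by simp
      then show ?thesis by (simp add: Phi_sym[OF hb])
    qed
    ultimately show ?thesis by simp
  qed
  moreover have "(\<lambda>n. Phi (h n) d) \<longlonglongrightarrow> Phi (\<lambda>t. 1) d"
  proof (rule Phi_limit[where K = 1])
    show "h n \<in> borel_measurable borel" for n by (rule bounded_borel_measurable[OF hb])
    show "\<bar>h n t\<bar> \<le> 1" for n t by (simp add: h_def indicator_def)
    show "(\<lambda>n. h n t) \<longlonglongrightarrow> 1" for t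
    proof -
      obtain N where "\<bar>f t\<bar> \<le> real N" using real_arch_simple by blast
      then have "\<forall>n\<ge>N. h n t = 1" by (auto simp: h_def indicator_def)
      then show ?thesis by (intro tendsto_eventually) (auto simp: eventually_sequentially)
    qed
  qed
  ultimately have "Phi (\<lambda>t. 1) d = 0" by (simp add: LIMSEQ_const_iff)
  moreover have "Phi (\<lambda>t. 1) d = d"
    using Phi_e[of UNIV d] by (simp add: E_UNIV indicator_def[abs_def])
  ultimately show ?thesis by simp
qed

text \<open>The calculus maps the truncations of \<open>f\<close> to bounded operators, whose values at \<open>x\<close> form a Cauchy
  sequence by dominated convergence. Their limit satisfies the condition that characterizes the spectral integral, and by
  density of the domain it is the only vector that does. So the definite description in
  \<open>spectral_integral\<close> is proper, and it inherits the isometry.\<close>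

theorem spectral_integral_limit:
  assumes f: "f \<in> borel_measurable borel" and x: "x \<in> domain f"
  shows "(\<lambda>n. Phi (trunc f n) x) \<longlonglongrightarrow> spectral_integral E f x"
    and "(norm (spectral_integral E f x))\<^sup>2 = (\<integral>t. (f t)\<^sup>2 \<partial>\<mu> x)"
proof -
  have int: "integrable (\<mu> x) (\<lambda>t. (f t)\<^sup>2)" using x by (simp add: spectral_integral_domain_def)
  have tb: "bounded_borel (trunc f n)" for n by (rule trunc_bb[OF f])
  have tm: "trunc f n \<in> borel_measurable borel" for n by (rule bounded_borel_measurable[OF tb])
  define a where "a N = (\<integral>t. (f t - trunc f N t)\<^sup>2 \<partial>\<mu> x)" for N
  have rest: "(f t - trunc f N t)\<^sup>2 \<le> (f t)\<^sup>2" for N t by (simp add: trunc_def indicator_def)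
  have resti: "integrable (\<mu> x) (\<lambda>t. (f t - trunc f N t)\<^sup>2)" for N
    using f tm rest by (intro Bochner_Integration.integrable_bound[OF int]) auto
  have "a \<longlonglongrightarrow> (\<integral>t. 0 \<partial>\<mu> x)"
    unfolding a_def
  proof (rule integral_dominated_convergence[where w = "\<lambda>t. (f t)\<^sup>2"])
    show "AE t in \<mu> x. (\<lambda>N. (f t - trunc f N t)\<^sup>2) \<longlonglongrightarrow> 0"
    proof (rule AE_I2)
      fix t
      have "(\<lambda>N. (f t - trunc f N t)\<^sup>2) \<longlonglongrightarrow> (f t - f t)\<^sup>2"
        by (intro tendsto_intros trunc_tendsto)
      then show "(\<lambda>N. (f t - trunc f N t)\<^sup>2) \<longlonglongrightarrow> 0" by simp
    qed
  qed (use f tm rest int in auto)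
  then have a0: "a \<longlonglongrightarrow> 0" by simp
  have d: "(norm (Phi (trunc f n) x - Phi (trunc f m) x))\<^sup>2 \<le> a N" if "N \<le> n" "N \<le> m" for n m N
  proof -
    have "(norm (Phi (trunc f n) x - Phi (trunc f m) x))\<^sup>2 = (\<integral>t. (trunc f n t - trunc f m t)\<^sup>2 \<partial>\<mu> x)"
      by (simp add: Phi_diff[OF tb tb, symmetric] norm_Phi[OF bounded_borel_diff[OF tb tb]])
    also have "\<dots> \<le> a N"
      unfolding a_def
    proof (rule integral_mono)
      show "integrable (\<mu> x) (\<lambda>t. (trunc f n t - trunc f m t)\<^sup>2)"
        by (intro integrable_mu bounded_borel_power2 bounded_borel_diff tb)
      show "integrable (\<mu> x) (\<lambda>t. (f t - trunc f N t)\<^sup>2)" by (rule resti)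
      show "(trunc f n t - trunc f m t)\<^sup>2 \<le> (f t - trunc f N t)\<^sup>2" for t
        using that by (auto simp: trunc_def indicator_def)
    qed
    finally show ?thesis .
  qed
  have "Cauchy (\<lambda>n. Phi (trunc f n) x)"
  proof (rule metric_CauchyI)
    fix e :: real assume e: "0 < e"
    then obtain N where N: "a N < e\<^sup>2"
      using order_tendstoD(2)[OF a0, of "e\<^sup>2"] by (auto simp: eventually_sequentially)
    have "dist (Phi (trunc f m) x) (Phi (trunc f n) x) < e" if "m \<ge> N" "n \<ge> N" for m n
      using d[OF that] N e power2_less_imp_less[of _ e] by (simp add: dist_norm)
    then show "\<exists>M. \<forall>m\<ge>M. \<forall>n\<ge>M. dist (Phi (trunc f m) x) (Phi (trunc f n) x) < e" by blast
  qed
  then obtain y where y: "(\<lambda>n. Phi (trunc f n) x) \<longlonglongrightarrow> y"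
    using Cauchy_convergent convergent_def by blast
  have "(\<lambda>n. (norm (Phi (trunc f n) x))\<^sup>2) \<longlonglongrightarrow> (\<integral>t. (f t)\<^sup>2 \<partial>\<mu> x)"
    unfolding norm_Phi[OF tb]
  proof (rule integral_dominated_convergence[where w = "\<lambda>t. (f t)\<^sup>2"])
    show "AE t in \<mu> x. (\<lambda>n. (trunc f n t)\<^sup>2) \<longlonglongrightarrow> (f t)\<^sup>2"
      by (intro AE_I2 tendsto_power trunc_tendsto)
  qed (use f tm int in \<open>auto simp: trunc_def indicator_def\<close>)
  then have ny: "(norm y)\<^sup>2 = (\<integral>t. (f t)\<^sup>2 \<partial>\<mu> x)"
    using LIMSEQ_unique tendsto_power[OF tendsto_norm[OF y]] by blast
  have conv: "(\<lambda>n. integral\<^sup>L (\<mu> v) (trunc f n)) \<longlonglongrightarrow> integral\<^sup>L (\<mu> v) f" if "v \<in> domain f" for v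
  proof (rule integral_dominated_convergence[where w = "\<lambda>t. \<bar>f t\<bar>"])
    show "integrable (\<mu> v) (\<lambda>t. \<bar>f t\<bar>)" using integrable_of_domain[OF f that] by simp
  qed (use f tm abs_trunc_le trunc_tendsto in auto)
  have inner_y: "inner y z = (integral\<^sup>L (\<mu> (x + z)) f - integral\<^sup>L (\<mu> (x - z)) f) / 4"
    if z: "z \<in> domain f" for z
  proof (rule LIMSEQ_unique)
    show "(\<lambda>n. inner (Phi (trunc f n) x) z) \<longlonglongrightarrow> inner y z" by (intro tendsto_intros y)
    show "(\<lambda>n. inner (Phi (trunc f n) x) z) \<longlonglongrightarrow>
        (integral\<^sup>L (\<mu> (x + z)) f - integral\<^sup>L (\<mu> (x - z)) f) / 4"
      unfolding inner_Phi[OF tb] I_def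
      by (intro tendsto_intros conv domain_add_diff[OF f x z]) simp
  qed
  have "spectral_integral E f x = y"
    unfolding spectral_integral_def
  proof (rule the_equality)
    fix y' assume y': "\<forall>z\<in>domain f. inner y' z =
        (integral\<^sup>L (\<mu> (x + z)) f - integral\<^sup>L (\<mu> (x - z)) f) / 4"
    have "y' - y = 0"
      by (rule eq_0_of_orthogonal_domain[OF f]) (simp add: inner_diff_left y' inner_y)
    then show "y' = y" by simp
  qed (use inner_y in blast)
  then show "(\<lambda>n. Phi (trunc f n) x) \<longlonglongrightarrow> spectral_integral E f x"
    "(norm (spectral_integral E f x))\<^sup>2 = (\<integral>t. (f t)\<^sup>2 \<partial>\<mu> x)" using y ny by auto
qed

end

text \<open>Every spectral measure of \<open>A\<close> gives this bound, whichever of them the operator power is built from: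
  the two sides are the integrals of \<open>\<bar>l\<bar>\<close> and \<open>1 + l\<^sup>2\<close> against the same measure.\<close>

lemma norm_operator_power_half:
  fixes D :: "'a::{real_inner, complete_space} set"
  assumes ex: "\<exists>E. is_spectral_measure D A E" and x: "x \<in> D"
  shows "(norm (operator_power D A (1/2) x))\<^sup>2 \<le> (norm x)\<^sup>2 + (norm (A x))\<^sup>2"
proof -
  define E where "E = spectral_measure D A"
  have E: "is_spectral_measure D A E" unfolding E_def spectral_measure_def using ex by (rule someI_ex)
  interpret spectral_family E UNIV
    using E by unfold_locales (auto simp: is_spectral_measure_def projection_valued_measure_def)
  let ?f = "\<lambda>l::real. l powr (1/2)"
  have sq: "(?f l)\<^sup>2 = \<bar>l\<bar>" for l
  proof (cases "l = 0")
    case False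
    \<comment> \<open>The logarithm is even on the real line, so \<open>l powr (1/2)\<close> is the root of \<open>\<bar>l\<bar>\<close>.\<close>
    have "ln l = ln \<bar>l\<bar>" using ln_minus[of l] by (cases "l < 0") auto
    then have "?f l = exp (ln \<bar>l\<bar> / 2)" using False by (simp add: powr_def)
    then have "(?f l)\<^sup>2 = exp (ln \<bar>l\<bar> / 2 + ln \<bar>l\<bar> / 2)"
      by (simp only: power2_eq_square exp_add)
    also have "ln \<bar>l\<bar> / 2 + ln \<bar>l\<bar> / 2 = ln \<bar>l\<bar>" by simp
    finally show ?thesis using False by simp
  qed simp
  have xd: "x \<in> domain (\<lambda>l. l)" and Ax: "A x = spectral_integral E (\<lambda>l. l) x"
    using E x by (auto simp: is_spectral_measure_def)
  have int: "integrable (\<mu> x) (\<lambda>l. 1 + l\<^sup>2)"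
    using xd integrable_mu[OF bounded_borel_const] by (auto simp: spectral_integral_domain_def)
  have le: "\<bar>l\<bar> \<le> 1 + l\<^sup>2" for l :: real
  proof -
    have "0 \<le> (\<bar>l\<bar> - 1)\<^sup>2" by simp
    then have "2 * \<bar>l\<bar> \<le> 1 + l\<^sup>2" by (simp add: power2_diff)
    then show ?thesis by simp
  qed
  have absi: "integrable (\<mu> x) (\<lambda>l. \<bar>l\<bar>)"
    using le by (intro Bochner_Integration.integrable_bound[OF int]) auto
  then have "x \<in> domain ?f" by (simp add: spectral_integral_domain_def sq)
  then have "(norm (operator_power D A (1/2) x))\<^sup>2 = (\<integral>l. \<bar>l\<bar> \<partial>\<mu> x)"
    using spectral_integral_limit(2)[of ?f x] by (simp add: operator_power_def E_def sq)
  also have "\<dots> \<le> (\<integral>l. 1 + l\<^sup>2 \<partial>\<mu> x)" by (rule integral_mono[OF absi int le])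
  also have "\<dots> = (norm x)\<^sup>2 + (norm (A x))\<^sup>2"
  proof -
    have "integrable (\<mu> x) (\<lambda>l. l\<^sup>2)" using xd by (simp add: spectral_integral_domain_def)
    moreover have "(norm (A x))\<^sup>2 = (\<integral>l. l\<^sup>2 \<partial>\<mu> x)"
      unfolding Ax by (rule spectral_integral_limit(2)[OF _ xd]) simp
    ultimately show ?thesis
      using integrable_mu[OF bounded_borel_const] by (simp add: measure_mu_UNIV)
  qed
  finally show ?thesis .
qed

section \<open>The spectral theorem for operators bounded below by a positive constant\<close>

text \<open>A self-adjoint operator is closed, so the lower bound makes its range closed; a vector
  orthogonal to the range lies in the kernel of the adjoint, hence in that of \<open>A\<close>.\<close>

lemma self_adjoint_inverse:
  fixes D :: "'a::{real_inner, complete_space} set"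
  assumes sa: "self_adjoint_operator D A" and \<nu>: "0 < \<nu>"
    and lower: "\<And>u. u \<in> D \<Longrightarrow> \<nu> * (norm u)\<^sup>2 \<le> inner (A u) u"
  obtains R where "\<And>w. R w \<in> D" "\<And>w. A (R w) = w" "\<And>u. u \<in> D \<Longrightarrow> R (A u) = u"
    "linear R" "\<And>x y. inner (R x) y = inner x (R y)"
    "\<And>w. 0 \<le> inner (R w) w" "\<And>w. \<nu> * inner (R w) w \<le> inner w w"
proof -
  have subD: "subspace D" and Aadd: "\<And>x y. x \<in> D \<Longrightarrow> y \<in> D \<Longrightarrow> A (x + y) = A x + A y"
    and Asc: "\<And>r x. x \<in> D \<Longrightarrow> A (r *\<^sub>R x) = r *\<^sub>R A x"
    using sa unfolding self_adjoint_operator_def linear_operator_def by auto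
  have adj: "y \<in> D \<and> A y = w \<longleftrightarrow> (\<forall>x\<in>D. inner (A x) y = inner x w)" for y w
  proof -
    have "(y, w) \<in> adjoint_graph D A \<longleftrightarrow> (y, w) \<in> graph_on D A"
      using sa unfolding self_adjoint_operator_def by simp
    then show ?thesis by (auto simp: adjoint_graph_def graph_on_def)
  qed
  have Adiff: "A (x - y) = A x - A y" if "x \<in> D" "y \<in> D" for x y
    using Aadd[of x "(-1) *\<^sub>R y"] Asc[of y "-1"] subspace_scale[OF subD that(2), of "-1"] that by simp
  have Ddiff: "x - y \<in> D" if "x \<in> D" "y \<in> D" for x y using subD that by (rule subspace_diff)
  have below: "\<nu> * norm u \<le> norm (A u)" if u: "u \<in> D" for u
  proof (cases "u = 0")
    case True
    then show ?thesis by simp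
  next
    case False
    have "\<nu> * norm u * norm u \<le> norm (A u) * norm u"
      using lower[OF u] norm_cauchy_schwarz[of "A u" u] by (simp add: power2_eq_square mult.assoc)
    then show ?thesis using False by simp
  qed
  have inj: "x = y" if "x \<in> D" "y \<in> D" "A x = A y" for x y
  proof -
    have "\<nu> * norm (x - y) \<le> 0" using below[OF Ddiff[OF that(1,2)]] Adiff[OF that(1,2)] that(3) by simp
    then show ?thesis using \<nu> by (simp add: mult_le_0_iff)
  qed
  have subR: "subspace (A ` D)"
    unfolding subspace_def
  proof (intro conjI ballI allI)
    have "A 0 = 0" using Asc[OF subspace_0[OF subD], of 0] by simp
    then show "0 \<in> A ` D" using subspace_0[OF subD] by (metis image_eqI)
    show "x + y \<in> A ` D" if "x \<in> A ` D" "y \<in> A ` D" for x y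
      using that Aadd subspace_add[OF subD] by (auto simp: image_iff) metis
    show "r *\<^sub>R x \<in> A ` D" if "x \<in> A ` D" for r x
      using that Asc subspace_scale[OF subD] by (auto simp: image_iff) metis
  qed
  have "closed (A ` D)"
    unfolding closed_sequential_limits
  proof (intro allI impI)
    fix a w assume "(\<forall>n::nat. a n \<in> A ` D) \<and> a \<longlonglongrightarrow> w"
    then have "\<forall>n. \<exists>v\<in>D. A v = a n" and aw: "a \<longlonglongrightarrow> w" by (auto simp: image_iff) metis
    then obtain v where v: "\<And>n. v n \<in> D" "\<And>n. A (v n) = a n" by metis
    have "Cauchy v"
    proof (rule metric_CauchyI)
      fix e :: real assume e: "0 < e"
      have "Cauchy a" using aw by (rule LIMSEQ_imp_Cauchy)
      then obtain N where N: "\<And>m n. m \<ge> N \<Longrightarrow> n \<ge> N \<Longrightarrow> dist (a m) (a n) < \<nu> * e"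
        using e \<nu> unfolding Cauchy_def by (meson mult_pos_pos)
      have "dist (v m) (v n) < e" if "m \<ge> N" "n \<ge> N" for m n
      proof -
        have "\<nu> * norm (v m - v n) < \<nu> * e"
          using below[OF Ddiff[OF v(1)[of m] v(1)[of n]]] N[OF that]
          by (simp add: Adiff v dist_norm)
        then show ?thesis using \<nu> by (simp add: dist_norm)
      qed
      then show "\<exists>M. \<forall>m\<ge>M. \<forall>n\<ge>M. dist (v m) (v n) < e" by blast
    qed
    then obtain l where l: "v \<longlonglongrightarrow> l" using Cauchy_convergent convergent_def by blast
    have "inner (A x) l = inner x w" if "x \<in> D" for x
    proof (rule LIMSEQ_unique)
      show "(\<lambda>n. inner (A x) (v n)) \<longlonglongrightarrow> inner (A x) l" by (intro tendsto_intros l)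
      have "inner (A x) (v n) = inner x (a n)" for n
        using adj[of "v n" "a n"] v that by blast
      then show "(\<lambda>n. inner (A x) (v n)) \<longlonglongrightarrow> inner x w" by (simp, intro tendsto_intros aw)
    qed
    then show "w \<in> A ` D" using adj[of l w] by blast
  qed
  have surj: "\<exists>v\<in>D. A v = w" for w
  proof -
    obtain s where s: "s \<in> A ` D" "\<forall>v\<in>A ` D. inner (w - s) v = 0"
      using closed_subspace_projection[OF subR \<open>closed (A ` D)\<close>] by blast
    have "\<forall>x\<in>D. inner (A x) (w - s) = inner x 0" using s(2) by (simp add: inner_commute)
    then have ker: "w - s \<in> D" "A (w - s) = 0" using adj[of "w - s" 0] by blast+
    have "\<nu> * norm (w - s) \<le> 0" using below[OF ker(1)] ker(2) by simp
    then have "w = s" using \<nu> by (simp add: mult_le_0_iff)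
    then show ?thesis using s(1) by auto
  qed
  define R where "R w = (SOME v. v \<in> D \<and> A v = w)" for w
  have R: "R w \<in> D" "A (R w) = w" for w
    using someI_ex[of "\<lambda>v. v \<in> D \<and> A v = w"] surj[of w] unfolding R_def by auto
  have RA: "R (A u) = u" if "u \<in> D" for u by (rule inj) (use R that in auto)
  have "linear R"
  proof (rule linearI)
    show "R (x + y) = R x + R y" for x y
      by (rule inj) (simp_all add: R Aadd subspace_add[OF subD])
    show "R (r *\<^sub>R x) = r *\<^sub>R R x" for r x
      by (rule inj) (simp_all add: R Asc subspace_scale[OF subD])
  qed
  moreover have "inner (R x) y = inner x (R y)" for x y
    using adj[of "R y" y] R(1)[of x] R[of y] R(2)[of x] by metis
  moreover have "0 \<le> inner (R w) w" for w
  proof -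
    have "0 \<le> \<nu> * (norm (R w))\<^sup>2" using \<nu> by simp
    also have "\<dots> \<le> inner w (R w)" using lower[OF R(1)[of w]] R(2)[of w] by simp
    finally show ?thesis by (simp add: inner_commute)
  qed
  moreover have "\<nu> * inner (R w) w \<le> inner w w" for w
  proof -
    have "\<nu> * inner (R w) w \<le> \<nu> * (norm (R w) * norm w)"
      using norm_cauchy_schwarz[of "R w" w] \<nu> by (intro mult_left_mono) auto
    also have "\<dots> \<le> norm w * norm w"
      using below[OF R(1)[of w]] R(2)[of w] by (simp add: mult.assoc[symmetric] mult_right_mono)
    finally show ?thesis by (simp add: dot_square_norm power2_eq_square)
  qed
  ultimately show thesis using that R RA by blast
qed

lemma sigma_functional_mono:
  assumes L: "sigma_functional S L" and S: "S \<subseteq> S'"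
  shows "sigma_functional S' L"
  using sigma_functional_image[OF L measurable_ident_sets[OF refl], of S'] S by auto

text \<open>The cut at \<open>\<nu>\<close> makes \<open>1 / l\<close> bounded without changing it on the spectrum of \<open>A\<close>.\<close>

definition cut_inverse :: "real \<Rightarrow> real \<Rightarrow> real" where
  "cut_inverse \<nu> l = indicator {\<nu>..} l / l"

lemma bounded_borel_cut_inverse:
  assumes "0 < \<nu>"
  shows "bounded_borel (cut_inverse \<nu>)"
proof (rule bounded_borelI)
  show "cut_inverse \<nu> \<in> borel_measurable borel" unfolding cut_inverse_def[abs_def] by measurable
  show "\<bar>cut_inverse \<nu> l\<bar> \<le> 1 / \<nu>" for l
    using assms by (auto simp: cut_inverse_def indicator_def intro: divide_left_mono)
qed

text \<open>The link between \<open>E\<close> and \<open>A\<close> is stated through the bounded inverse \<open>R\<close>, which keeps it within the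
  bounded calculus.\<close>

locale positive_spectral_family = spectral_family E "{\<nu>..}"
  for E :: "real set \<Rightarrow> 'a::{real_inner, complete_space} \<Rightarrow> 'a" and \<nu> :: real +
  fixes D :: "'a set" and A R :: "'a \<Rightarrow> 'a"
  assumes nu_pos: "0 < \<nu>"
    and R_mem: "R w \<in> D" and A_R: "A (R w) = w" and R_A: "u \<in> D \<Longrightarrow> R (A u) = u"
    and R_Phi: "R w = Phi (cut_inverse \<nu>) w"

text \<open>The calculus of the contraction \<open>\<nu> A\<^sup>-\<^sup>1\<close> is transported by \<open>t \<mapsto> \<nu> / t\<close>. The point \<open>0\<close>, where this map
  is arbitrary, carries no mass because \<open>A\<^sup>-\<^sup>1\<close> is injective.\<close>

theorem positive_spectral_family_exists:
  fixes D :: "'a::{real_inner, complete_space} set"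
  assumes sa: "self_adjoint_operator D A" and \<nu>: "0 < \<nu>"
    and lower: "\<And>u. u \<in> D \<Longrightarrow> \<nu> * (norm u)\<^sup>2 \<le> inner (A u) u"
  shows "\<exists>E R. positive_spectral_family E \<nu> D A R"
proof -
  obtain R where R: "\<And>w. R w \<in> D" "\<And>w. A (R w) = w" "\<And>u. u \<in> D \<Longrightarrow> R (A u) = u"
    "linear R" and Rsym: "\<And>x y. inner (R x) y = inner x (R y)"
    and Rpos: "\<And>w. 0 \<le> inner (R w) w" and Rle: "\<And>w. \<nu> * inner (R w) w \<le> inner w w"
    using self_adjoint_inverse[OF sa \<nu> lower] by blast
  define T where "T x = \<nu> *\<^sub>R R x" for x
  have T: "linear T" unfolding T_def using R(4) by (rule linear_compose_scale_right)
  obtain J where "calculus_seed {0..1} J UNIV (\<lambda>p t. poly p (clip t)) (opoly T) (*)"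
    using positive_contraction_calculus[OF T] Rsym Rpos Rle \<nu> by (auto simp: T_def)
  then interpret C: calculus_seed "{0..1}" J UNIV "\<lambda>p t. poly p (clip t)" "opoly T" "(*)" .
  define k where "k t = \<nu> / t" for t :: real
  have k: "k \<in> borel_measurable borel" unfolding k_def[abs_def] by measurable
  define E where "E B = C.Phi (\<lambda>t. indicator B (k t))" for B
  have bk: "bounded_borel (\<lambda>t. indicator B (k t))" if "B \<in> sets borel" for B
    using bounded_borel_compose[OF bounded_borel_indicator[OF that] k] .
  have J1: "J x (\<lambda>t. 1) = (norm x)\<^sup>2" for x
    using C.J_e[of 1 x] by (simp add: opoly_1[OF T] power2_norm_eq_inner)
  have pvm: "projection_valued_measure E"
    unfolding E_def[abs_def] by (rule C.projection_valued_measure_Phi[OF J1 k])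
  have Phi1: "C.Phi (\<lambda>t. 1) x = x" for x
    using C.Phi_e[of 1 x] by (simp add: opoly_1[OF T])
  have Phi_clip: "C.Phi clip x = T x" for x
    using C.Phi_e[of "[:0, 1:]" x] by (simp add: opoly_X[OF T])
  have clip_bb: "bounded_borel clip"
    using bounded_borel_continuous_clip[of "\<lambda>t. t"] by simp
  have k_ge: "\<nu> \<le> k t" if "t \<in> {0..1}" "t \<noteq> 0" for t
    using that \<nu> by (simp add: k_def pos_le_divide_eq mult_left_le)
  have S: "E {\<nu>..} x = x" for x
  proof -
    have ib: "bounded_borel (indicator {0})" by (rule bounded_borel_indicator) simp
    have "T (C.Phi (indicator {0}) x) = C.Phi (\<lambda>t. clip t * indicator {0} t) x"
      by (simp add: C.Phi_mult[OF clip_bb ib] Phi_clip)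
    also have "(\<lambda>t. clip t * indicator {0} t) = (\<lambda>t. 0 * 1)"
      by (auto simp: fun_eq_iff indicator_def clip_def)
    also have "C.Phi (\<lambda>t. 0 * 1) x = 0"
      using C.Phi_cmult[OF bounded_borel_const, of 0 1 x] by simp
    finally have "R (C.Phi (indicator {0}) x) = 0" using \<nu> by (simp add: T_def)
    then have "C.Phi (indicator {0}) x = A 0" using R(2)[of "C.Phi (indicator {0}) x"] by simp
    also have "A 0 = 0" using R(2)[of 0] linear_0[OF R(4)] by simp
    finally have z: "C.Phi (indicator {0}) x = 0" .
    have "E {\<nu>..} x = C.Phi (\<lambda>t. 1 - indicator {0} t) x"
      unfolding E_def
    proof (rule C.Phi_cong)
      show "indicator {\<nu>..} (k t) = 1 - (indicator {0} t :: real)" if "t \<in> {0..1}" for t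
        using k_ge[OF that] \<nu> by (cases "t = 0") (auto simp: k_def)
      show "bounded_borel (\<lambda>t. indicator {\<nu>..} (k t))" by (rule bk) simp
      show "bounded_borel (\<lambda>t. 1 - indicator {0} t)"
        by (rule bounded_borel_diff[OF bounded_borel_const ib])
    qed
    then show ?thesis by (simp add: C.Phi_diff[OF bounded_borel_const ib] Phi1 z)
  qed
  interpret F: spectral_family E "{\<nu>..}" using pvm S by unfold_locales auto
  \<comment> \<open>The comparison is made for functionals on the whole line, since \<open>k\<close> does not map \<open>0\<close> into \<open>{\<nu>..}\<close>.\<close>
  have transfer: "F.I x y g = C.I x y (\<lambda>t. g (k t))" if g: "bounded_borel g" for x y g
  proof -
    have "sigma_functional UNIV (\<lambda>g. F.I x y g - C.I x y (\<lambda>t. g (k t)))"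
      by (intro sigma_functional_difference sigma_functional_mono[OF F.I_sf]
          sigma_functional_image[OF C.I_sf k]) auto
    from sigma_functional_eq_0_of_indicators[OF this _ g]
    have "F.I x y g - C.I x y (\<lambda>t. g (k t)) = 0"
      by (simp add: F.I_e E_def C.inner_Phi bk)
    then show ?thesis by simp
  qed
  have "R w = F.Phi (cut_inverse \<nu>) w" for w
  proof (rule eq_of_inner_eq)
    fix y
    have b: "bounded_borel (cut_inverse \<nu>)" by (rule bounded_borel_cut_inverse[OF \<nu>])
    have "inner (F.Phi (cut_inverse \<nu>) w) y = C.I w y (\<lambda>t. cut_inverse \<nu> (k t))"
      by (simp add: F.inner_Phi[OF b] transfer[OF b])
    also have "\<dots> = C.I w y (\<lambda>t. (1 / \<nu>) * clip t)"
    proof (rule sigma_functional_cong[OF C.I_sf])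
      show "cut_inverse \<nu> (k t) = 1 / \<nu> * clip t" if "t \<in> {0..1}" for t
        using k_ge[OF that] that \<nu> by (cases "t = 0") (auto simp: cut_inverse_def clip_id k_def)
    qed (intro bounded_borel_compose[OF b k] bounded_borel_cmult clip_bb)+
    also have "\<dots> = (1 / \<nu>) * C.I w y clip" by (rule sigma_functional_cmult[OF C.I_sf clip_bb])
    also have "C.I w y clip = inner (T w) y" by (simp add: C.inner_Phi[OF clip_bb, symmetric] Phi_clip)
    also have "(1 / \<nu>) * inner (T w) y = inner (R w) y" using \<nu> by (simp add: T_def)
    finally show "inner (R w) y = inner (F.Phi (cut_inverse \<nu>) w) y" by simp
  qed
  then have "positive_spectral_family E \<nu> D A R"
    using R \<nu> by unfold_locales auto
  then show ?thesis by blast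
qed

context positive_spectral_family
begin

lemma bb_inv: "bounded_borel (cut_inverse \<nu>)"
  by (rule bounded_borel_cut_inverse[OF nu_pos])

lemma Phi_indicator_nu: "Phi (indicator {\<nu>..}) x = x"
  using Phi_e[of "{\<nu>..}" x] E_S by simp

text \<open>The vectors \<open>Phi (trunc (\<lambda>l. l) n) x\<close> converge, and \<open>R\<close> maps them to \<open>E {\<nu>..n} x\<close>, which converges to \<open>x\<close>. So \<open>R\<close>
  sends their limit to \<open>x\<close>.\<close>

lemma domain_imp_mem:
  assumes x: "x \<in> domain (\<lambda>l. l)"
  shows "x \<in> D" and "A x = spectral_integral E (\<lambda>l. l) x"
proof -
  let ?y = "spectral_integral E (\<lambda>l. l) x"
  have tb: "bounded_borel (trunc (\<lambda>l. l) n)" for n by (rule trunc_bb) simp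
  have "(\<lambda>n. Phi (trunc (\<lambda>l. l) n) x) \<longlonglongrightarrow> ?y" by (rule spectral_integral_limit(1)[OF _ x]) simp
  then have "(\<lambda>n. R (Phi (trunc (\<lambda>l. l) n) x)) \<longlonglongrightarrow> R ?y"
    unfolding R_Phi by (rule bounded_linear.tendsto[OF bounded_linear_Phi[OF bb_inv]])
  moreover have "(\<lambda>n. R (Phi (trunc (\<lambda>l. l) n) x)) \<longlonglongrightarrow> Phi (indicator {\<nu>..}) x"
    unfolding R_Phi Phi_mult[OF bb_inv tb, symmetric]
  proof (rule Phi_limit[where K = 1])
    show "(\<lambda>t. cut_inverse \<nu> t * trunc (\<lambda>l. l) n t) \<in> borel_measurable borel" for n
      by (intro bounded_borel_measurable bounded_borel_mult bb_inv tb)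
    show "\<bar>cut_inverse \<nu> t * trunc (\<lambda>l. l) n t\<bar> \<le> 1" for n t
      by (simp add: cut_inverse_def trunc_def indicator_def)
    show "(\<lambda>n. cut_inverse \<nu> t * trunc (\<lambda>l. l) n t) \<longlonglongrightarrow> indicator {\<nu>..} t" for t
    proof -
      have "(\<lambda>n. cut_inverse \<nu> t * trunc (\<lambda>l. l) n t) \<longlonglongrightarrow> cut_inverse \<nu> t * t"
        by (intro tendsto_mult_left trunc_tendsto)
      moreover have "cut_inverse \<nu> t * t = indicator {\<nu>..} t"
        using nu_pos by (auto simp: cut_inverse_def indicator_def)
      ultimately show ?thesis by simp
    qed
  qed
  ultimately have "R ?y = x" unfolding Phi_indicator_nu by (rule LIMSEQ_unique)
  then show "x \<in> D" "A x = ?y" using R_mem[of ?y] A_R[of ?y] by auto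
qed

text \<open>Writing \<open>x = R (A x)\<close> multiplies the measure of \<open>A x\<close> by \<open>1 / l\<^sup>2\<close>, which absorbs the factor \<open>l\<^sup>2\<close>.\<close>

lemma mem_imp_domain:
  assumes x: "x \<in> D"
  shows "x \<in> domain (\<lambda>l. l)"
proof -
  have xR: "x = Phi (cut_inverse \<nu>) (A x)" using R_A[OF x] R_Phi by simp
  have "(\<integral>l. min (l\<^sup>2) (real n) \<partial>\<mu> x) \<le> 1 * (norm (A x))\<^sup>2" for n
  proof -
    have bb: "bounded_borel (\<lambda>l. min (l\<^sup>2) (real n))"
      by (intro bounded_borelI[of _ "real n"]) auto
    have "\<bar>min (l\<^sup>2) (real n) * (cut_inverse \<nu> l)\<^sup>2\<bar> \<le> 1" if "l \<in> {\<nu>..}" for l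
    proof -
      have "0 < l" using that nu_pos by simp
      then have "(cut_inverse \<nu> l)\<^sup>2 = 1 / l\<^sup>2"
        using that by (simp add: cut_inverse_def power_divide)
      then show ?thesis using \<open>0 < l\<close> by (simp add: divide_le_eq_1)
    qed
    then have "\<bar>\<integral>l. min (l\<^sup>2) (real n) * (cut_inverse \<nu> l)\<^sup>2 \<partial>\<mu> (A x)\<bar> \<le> 1 * (norm (A x))\<^sup>2"
      by (intro integral_mu_bound bounded_borel_mult bb bounded_borel_power2 bb_inv)
    then show ?thesis
      using integral_Phi[OF bb bb_inv, of "A x"] xR by simp
  qed
  then show ?thesis using domain_iff[of "\<lambda>l. l" x] by auto
qed

theorem is_spectral_measure: "is_spectral_measure D A E"
  unfolding is_spectral_measure_def
  using pvm domain_imp_mem mem_imp_domain by blast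

end

section \<open>The semigroup generated by \<open>- A\<close>\<close>

lemma has_vector_derivative_of_quotient:
  fixes f :: "real \<Rightarrow> 'a::real_normed_vector"
  assumes "((\<lambda>y. (1 / (y - x)) *\<^sub>R (f y - f x)) \<longlongrightarrow> f') (at x within S)"
  shows "(f has_vector_derivative f') (at x within S)"
  unfolding has_vector_derivative_def has_derivative_within
proof
  show "bounded_linear (\<lambda>h. h *\<^sub>R f')" by (rule bounded_linear_scaleR_left)
  have "((\<lambda>y. norm ((1 / (y - x)) *\<^sub>R (f y - f x) - f')) \<longlongrightarrow> 0) (at x within S)"
    by (intro tendsto_norm_zero LIM_zero assms)
  moreover have "\<forall>\<^sub>F y in at x within S. norm ((1 / (y - x)) *\<^sub>R (f y - f x) - f')
      = norm ((1 / norm (y - x)) *\<^sub>R (f y - (f x + (y - x) *\<^sub>R f')))"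
    unfolding eventually_at_filter
  proof (rule always_eventually, intro allI impI)
    fix y assume "y \<noteq> x"
    then have "(1 / (y - x)) *\<^sub>R (f y - f x) - f' = (1 / (y - x)) *\<^sub>R (f y - (f x + (y - x) *\<^sub>R f'))"
      by (simp add: scaleR_diff_right scaleR_add_right)
    then show "norm ((1 / (y - x)) *\<^sub>R (f y - f x) - f')
      = norm ((1 / norm (y - x)) *\<^sub>R (f y - (f x + (y - x) *\<^sub>R f')))" by simp
  qed
  ultimately have "((\<lambda>y. norm ((1 / norm (y - x)) *\<^sub>R (f y - (f x + (y - x) *\<^sub>R f')))) \<longlongrightarrow> 0)
      (at x within S)" by (rule Lim_transform_eventually)
  then show "((\<lambda>y. (1 / norm (y - x)) *\<^sub>R (f y - (f x + (y - x) *\<^sub>R f'))) \<longlongrightarrow> 0) (at x within S)"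
    by (rule tendsto_norm_zero_cancel)
qed

lemma abs_exp_minus_diff_le:
  fixes a b :: real
  assumes "0 \<le> a" "0 \<le> b"
  shows "\<bar>exp (- a) - exp (- b)\<bar> \<le> \<bar>a - b\<bar>"
proof -
  have *: "exp (- a) - exp (- b) \<le> b - a" "exp (- b) \<le> exp (- a)" if "0 \<le> a" "a \<le> b" for a b :: real
  proof -
    have "exp (- b) = exp (- a) * exp (- (b - a))" by (simp add: exp_add[symmetric])
    then have "exp (- a) - exp (- b) = exp (- a) * (1 - exp (- (b - a)))"
      by (simp add: right_diff_distrib)
    also have "\<dots> \<le> 1 * (b - a)"
    proof (rule mult_mono)
      show "1 - exp (- (b - a)) \<le> b - a" using exp_ge_add_one_self[of "- (b - a)"] by linarith
    qed (use that in auto)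
    finally show "exp (- a) - exp (- b) \<le> b - a" by simp
    show "exp (- b) \<le> exp (- a)" using that by simp
  qed
  show ?thesis using *[of a b] *[of b a] assms by (cases "a \<le> b") auto
qed

context positive_spectral_family
begin

text \<open>The function of \<open>l\<close> whose calculus is the operator \<open>exp (- s A)\<close>.\<close>

definition heat :: "real \<Rightarrow> real \<Rightarrow> real" where
  "heat s l = indicator {\<nu>..} l * exp (- (s * l))"

lemma heat_bound: "0 \<le> s \<Longrightarrow> \<bar>heat s l\<bar> \<le> 1"
  using nu_pos by (simp add: heat_def indicator_def)

lemma heat_bb: "0 \<le> s \<Longrightarrow> bounded_borel (heat s)"
  using heat_bound by (intro bounded_borelI[of _ 1]) (auto simp: heat_def[abs_def])

lemma norm_heat_le:
  assumes "0 \<le> s"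
  shows "norm (Phi (heat s) w) \<le> exp (- (\<nu> * s)) * norm w"
proof (rule norm_Phi_le[OF heat_bb[OF assms]])
  show "\<bar>heat s l\<bar> \<le> exp (- (\<nu> * s))" if "l \<in> {\<nu>..}" for l
    using that assms by (simp add: heat_def mult_right_mono mult.commute[of s])
qed simp

lemma norm_R_le: "norm (R w) \<le> 1 / \<nu> * norm w"
  unfolding R_Phi
proof (rule norm_Phi_le[OF bb_inv])
  show "\<bar>cut_inverse \<nu> l\<bar> \<le> 1 / \<nu>" if "l \<in> {\<nu>..}" for l
    using that nu_pos by (auto simp: cut_inverse_def intro: divide_left_mono)
qed (use nu_pos in simp)

lemma heat_0: "Phi (heat 0) w = w"
proof -
  have "heat 0 = indicator {\<nu>..}" by (simp add: heat_def fun_eq_iff)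
  then show ?thesis using Phi_indicator_nu by simp
qed

lemma continuous_on_heat: "continuous_on {0..} (\<lambda>s. Phi (heat s) w)"
  unfolding continuous_on_sequentially comp_def
proof (intro ballI allI impI, elim conjE)
  fix s and \<sigma> :: "nat \<Rightarrow> real"
  assume s: "s \<in> {0..}" "\<forall>n. \<sigma> n \<in> {0..}" "\<sigma> \<longlonglongrightarrow> s"
  show "(\<lambda>n. Phi (heat (\<sigma> n)) w) \<longlonglongrightarrow> Phi (heat s) w"
  proof (rule Phi_limit[where K = 1])
    show "heat (\<sigma> n) \<in> borel_measurable borel" for n
      using s(2) by (intro bounded_borel_measurable heat_bb) auto
    show "\<bar>heat (\<sigma> n) l\<bar> \<le> 1" for n l using s(2) by (intro heat_bound) auto
    show "(\<lambda>n. heat (\<sigma> n) l) \<longlonglongrightarrow> heat s l" for l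
      unfolding heat_def by (intro tendsto_intros s(3))
  qed
qed

text \<open>After division by \<open>l\<close> the difference quotients of \<open>exp (- s l)\<close> in \<open>s\<close> are bounded by \<open>1\<close>, so
  bounded convergence gives the derivative.\<close>

lemma R_heat_has_vector_derivative:
  assumes s: "0 \<le> s"
  shows "((\<lambda>s. R (Phi (heat s) w)) has_vector_derivative - Phi (heat s) w) (at s within {0..})"
proof (rule has_vector_derivative_of_quotient, unfold tendsto_at_iff_sequentially comp_def,
    intro allI impI)
  fix \<sigma> :: "nat \<Rightarrow> real"
  assume \<sigma>: "\<forall>i. \<sigma> i \<in> {0..} - {s}" "\<sigma> \<longlonglongrightarrow> s"
  then have \<sigma>0: "0 \<le> \<sigma> n" "\<sigma> n \<noteq> s" for n by auto
  define q where "q n l = 1 / (\<sigma> n - s) * (cut_inverse \<nu> l * heat (\<sigma> n) l - cut_inverse \<nu> l * heat s l)" for n l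
  have b1: "bounded_borel (\<lambda>l. cut_inverse \<nu> l * heat s l)" if "0 \<le> s" for s
    by (rule bounded_borel_mult[OF bb_inv heat_bb[OF that]])
  have qb: "bounded_borel (q n)" for n
    unfolding q_def by (intro bounded_borel_cmult bounded_borel_diff b1 s \<sigma>0)
  have R_heat: "R (Phi (heat s) w) = Phi (\<lambda>l. cut_inverse \<nu> l * heat s l) w" if "0 \<le> s" for s
    by (simp add: R_Phi Phi_mult[OF bb_inv heat_bb[OF that]])
  have "(1 / (\<sigma> n - s)) *\<^sub>R (R (Phi (heat (\<sigma> n)) w) - R (Phi (heat s) w)) = Phi (q n) w" for n
    unfolding R_heat[OF s] R_heat[OF \<sigma>0(1)] q_def
    by (simp only: Phi_cmult[OF bounded_borel_diff[OF b1[OF \<sigma>0(1)] b1[OF s]]]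
        Phi_diff[OF b1[OF \<sigma>0(1)] b1[OF s]])
  moreover have "(\<lambda>n. Phi (q n) w) \<longlonglongrightarrow> Phi (\<lambda>l. (-1) * heat s l) w"
  proof (rule Phi_limit[where K = 1])
    show "q n \<in> borel_measurable borel" for n by (rule bounded_borel_measurable[OF qb])
    show "\<bar>q n l\<bar> \<le> 1" for n l
    proof (cases "l \<in> {\<nu>..}")
      case False
      then show ?thesis by (simp add: q_def heat_def)
    next
      case True
      then have l: "0 < l" using nu_pos by simp
      have "q n l = (exp (- (\<sigma> n * l)) - exp (- (s * l))) / ((\<sigma> n - s) * l)"
        using True by (simp add: q_def heat_def cut_inverse_def diff_divide_distrib[symmetric] mult_ac)
      moreover have "\<bar>exp (- (\<sigma> n * l)) - exp (- (s * l))\<bar> \<le> \<bar>(\<sigma> n - s) * l\<bar>"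
        using abs_exp_minus_diff_le[of "\<sigma> n * l" "s * l"] \<sigma>0(1)[of n] s l by (simp add: left_diff_distrib)
      ultimately show ?thesis using \<sigma>0(2)[of n] l by (simp add: abs_divide divide_le_eq_1)
    qed
    show "(\<lambda>n. q n l) \<longlonglongrightarrow> (-1) * heat s l" for l
    proof (cases "l \<in> {\<nu>..}")
      case False
      then show ?thesis by (simp add: q_def heat_def)
    next
      case True
      then have l: "0 < l" using nu_pos by simp
      have "((\<lambda>s. exp (- (s * l)) / l) has_real_derivative - exp (- (s * l))) (at s within {0..})"
        using l by (auto intro!: derivative_eq_intros simp: field_simps)
      then have "((\<lambda>y. (exp (- (y * l)) / l - exp (- (s * l)) / l) / (y - s)) \<longlongrightarrow> - exp (- (s * l)))
          (at s within {0..})" by (simp add: has_field_derivative_iff)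
      then have "(\<lambda>n. (exp (- (\<sigma> n * l)) / l - exp (- (s * l)) / l) / (\<sigma> n - s)) \<longlonglongrightarrow> - exp (- (s * l))"
        using \<sigma> unfolding tendsto_at_iff_sequentially comp_def by blast
      then show ?thesis using True by (simp add: q_def heat_def cut_inverse_def)
    qed
  qed
  ultimately show "(\<lambda>n. (1 / (\<sigma> n - s)) *\<^sub>R (R (Phi (heat (\<sigma> n)) w) - R (Phi (heat s) w)))
      \<longlonglongrightarrow> - Phi (heat s) w"
    using Phi_cmult[OF heat_bb[OF s], of "-1" w] by simp
qed

end

section \<open>The evolution problem\<close>

lemma at_within_half_line: "0 < t \<Longrightarrow> at t within {0..} = at (t::real)"
  by (rule at_within_nhd[of _ "{0<..}"]) auto

lemma at_within_half_line_nontrivial: "0 \<le> t \<Longrightarrow> at (t::real) within {0..} \<noteq> bot"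
proof
  assume "0 \<le> t" "at t within {0..} = bot"
  moreover have "at_right t \<le> at t within {0..}" using \<open>0 \<le> t\<close> by (intro at_le) auto
  ultimately have "at_right t = bot" by (simp add: bot.extremum_unique)
  then show False using trivial_limit_at_right_real[of t] by simp
qed

text \<open>The new time variable, in which the equation becomes \<open>u' = - A u\<close>.\<close>

lemma time_change:
  fixes c :: "real \<Rightarrow> real"
  assumes c: "continuous_on {0..} c" and p: "0 \<le> p" and low: "\<And>t. 0 \<le> t \<Longrightarrow> m \<le> c t" and m: "0 < m"
  obtains \<phi> where "\<phi> 0 = 0"
    "\<And>t. 0 \<le> t \<Longrightarrow> (\<phi> has_vector_derivative (1 + t) powr p * c t) (at t within {0..})"
    "\<And>t. 0 \<le> t \<Longrightarrow> m / (1 + p) * ((1 + t) powr (1 + p) - 1) \<le> \<phi> t"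
proof -
  define f where "f s = (1 + s) powr p * c s" for s
  define \<phi> where "\<phi> t = integral {0..t} f" for t
  have fc: "continuous_on {0..} f"
    unfolding f_def by (intro continuous_intros c) auto
  have d: "(\<phi> has_vector_derivative f t) (at t within {0..})" if t: "0 \<le> t" for t
  proof -
    have "(\<phi> has_vector_derivative f t) (at t within {0..t + 1})"
      unfolding \<phi>_def using t
      by (intro integral_has_vector_derivative continuous_on_subset[OF fc]) auto
    moreover have "at t within {0..t + 1} = at t within {0..}"
      by (rule at_within_nhd[of _ "{..<t + 1}"]) auto
    ultimately show ?thesis by simp
  qed
  have lower: "m / (1 + p) * ((1 + t) powr (1 + p) - 1) \<le> \<phi> t" if t: "0 \<le> t" for t
  proof -
    define g where "g s = m / (1 + p) * ((1 + s) powr (1 + p) - 1) - \<phi> s" for s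
    have "g t \<le> g 0"
    proof (rule DERIV_nonpos_imp_decreasing_open[OF t])
      fix s assume s: "0 < s" "s < t"
      have "(\<phi> has_real_derivative f s) (at s)"
        using d[of s] s at_within_half_line[of s] by (simp add: has_real_derivative_iff_has_vector_derivative)
      moreover have "((\<lambda>s. m / (1 + p) * ((1 + s) powr (1 + p) - 1))
          has_real_derivative m * (1 + s) powr p) (at s)"
      proof -
        have "((\<lambda>s. (1 + s) powr (1 + p)) has_real_derivative (1 + p) * (1 + s) powr p) (at s)"
          using s by (auto intro!: derivative_eq_intros)
        from DERIV_cmult[OF DERIV_diff[OF this DERIV_const[of 1]], of "m / (1 + p)"]
        show ?thesis using p by simp
      qed
      ultimately have "(g has_real_derivative m * (1 + s) powr p - f s) (at s)"
        unfolding g_def by (rule DERIV_diff[rotated])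
      moreover have "m * (1 + s) powr p \<le> f s"
        unfolding f_def using low[of s] s by (simp add: mult.commute mult_left_mono)
      ultimately show "\<exists>y. (g has_real_derivative y) (at s) \<and> y \<le> 0" by (intro exI conjI) auto
    next
      have "continuous_on {0..} \<phi>"
        using d by (auto simp: continuous_on_eq_continuous_within intro: has_vector_derivative_continuous)
      then have "continuous_on {0..t} \<phi>" by (rule continuous_on_subset) auto
      then show "continuous_on {0..t} g"
        unfolding g_def by (intro continuous_intros) auto
    qed
    then show ?thesis by (simp add: g_def \<phi>_def)
  qed
  show thesis
    by (rule that[of \<phi>]) (use d lower in \<open>auto simp: f_def \<phi>_def\<close>)
qed

lemma global_solution_derivative:
  assumes "global_solution D A p c u0 u" and t: "0 \<le> t"
  shows "(u has_vector_derivative - ((1 + t) powr p * c t) *\<^sub>R A (u t)) (at t within {0..})"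
proof -
  let ?d = "half_line_deriv u t"
  have "(u has_vector_derivative ?d) (at t within {0..})"
    using assms by (simp add: global_solution_def C1_half_line_def vector_derivative_works)
  moreover have "(1 / (1 + t) powr p) *\<^sub>R ?d + c t *\<^sub>R A (u t) = 0"
    using assms by (simp add: global_solution_def)
  then have "(1 + t) powr p *\<^sub>R ((1 / (1 + t) powr p) *\<^sub>R ?d + c t *\<^sub>R A (u t)) = 0" by simp
  then have "?d + ((1 + t) powr p * c t) *\<^sub>R A (u t) = 0"
    using t by (simp add: scaleR_add_right)
  then have "?d = - ((1 + t) powr p * c t) *\<^sub>R A (u t)" by (simp add: eq_neg_iff_add_eq_0)
  ultimately show ?thesis by simp
qed

text \<open>The squared norm of the difference of two solutions is nonincreasing, since \<open>A\<close> is monotone.\<close>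

lemma global_solution_unique:
  assumes lin: "linear_operator D A" and mono: "\<And>x. x \<in> D \<Longrightarrow> 0 \<le> inner (A x) x"
    and c: "\<And>t. 0 \<le> t \<Longrightarrow> 0 \<le> c t"
    and u: "global_solution D A p c u0 u" and v: "global_solution D A p c u0 v" and t: "0 \<le> t"
  shows "v t = u t"
proof -
  define w where "w s = v s - u s" for s
  define a where "a s = (1 + s) powr p * c s" for s
  have uD: "u s \<in> D" "v s \<in> D" if "0 \<le> s" for s
    using u v that by (auto simp: global_solution_def continuous_into_domain_def)
  have wD: "w s \<in> D" "A (w s) = A (v s) - A (u s)" if "0 \<le> s" for s
  proof -
    have sub: "subspace D" using lin by (simp add: linear_operator_def)
    show "w s \<in> D" unfolding w_def by (rule subspace_diff[OF sub uD(2)[OF that] uD(1)[OF that]])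
    have m: "(-1) *\<^sub>R u s \<in> D" by (rule subspace_scale[OF sub uD(1)[OF that]])
    have "A (v s + (-1) *\<^sub>R u s) = A (v s) + (-1) *\<^sub>R A (u s)"
      using lin uD[OF that] m unfolding linear_operator_def by metis
    then show "A (w s) = A (v s) - A (u s)" by (simp add: w_def)
  qed
  have dw: "(w has_vector_derivative - a s *\<^sub>R A (w s)) (at s within {0..})" if "0 \<le> s" for s
    unfolding w_def
    using has_vector_derivative_diff[OF global_solution_derivative[OF v that] global_solution_derivative[OF u that]]
    by (simp add: a_def wD(2)[OF that, unfolded w_def] scaleR_diff_right)
  define N where "N s = inner (w s) (w s)" for s
  have dN: "(N has_real_derivative - 2 * a s * inner (A (w s)) (w s)) (at s within {0..})"
    if "0 \<le> s" for s
    unfolding N_def has_real_derivative_iff_has_vector_derivative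
    using bounded_bilinear.has_vector_derivative[OF bounded_bilinear_inner dw[OF that] dw[OF that]]
    by (simp add: inner_commute mult.assoc)
  have "N t \<le> N 0"
  proof (rule DERIV_nonpos_imp_decreasing_open[OF t])
    fix s assume s: "0 < s" "s < t"
    have "0 \<le> a s * inner (A (w s)) (w s)"
      using c[of s] mono[OF wD(1)[of s]] s by (simp add: a_def)
    then show "\<exists>y. (N has_real_derivative y) (at s) \<and> y \<le> 0"
      using dN[of s] s at_within_half_line[of s] by (intro exI conjI) auto
  next
    have "continuous_on {0..} N"
      using dN by (auto simp: continuous_on_eq_continuous_within intro: DERIV_continuous)
    then show "continuous_on {0..t} N" by (rule continuous_on_subset) auto
  qed
  moreover have "w 0 = 0" using u v by (simp add: w_def global_solution_def)
  ultimately have "inner (w t) (w t) \<le> 0" by (simp add: N_def)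
  then have "w t = 0" by (metis inner_ge_zero inner_eq_zero_iff order_antisym)
  then show ?thesis by (simp add: w_def)
qed

context positive_spectral_family
begin

text \<open>The solution is \<open>exp (- \<phi>(t) A) u0\<close>. It is written as \<open>R (exp (- \<phi>(t) A) (A u0))\<close>, so that membership in
  \<open>D\<close> is evident and \<open>A u\<close> is an orbit of the semigroup; the semigroup bound then controls \<open>A u\<close>, and
  through it every term of the estimate.\<close>

lemma solution_exists:
  assumes lin: "linear_operator D A" and u0: "u0 \<in> D"
    and c: "continuous_on {0..} c" and p: "0 \<le> p"
    and low: "\<And>t. 0 \<le> t \<Longrightarrow> m \<le> c t" and m: "0 < m"
  obtains u where "global_solution D A p c u0 u"
    "\<And>t. 0 \<le> t \<Longrightarrow> norm (u t) \<le> 1 / \<nu> * norm (A (u t))"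
    "\<And>t. 0 \<le> t \<Longrightarrow>
      norm (A (u t)) \<le> exp (- (\<nu> * (m / (1 + p) * ((1 + t) powr (1 + p) - 1)))) * norm (A u0)"
    "\<And>t. 0 \<le> t \<Longrightarrow> half_line_deriv u t = - ((1 + t) powr p * c t) *\<^sub>R A (u t)"
proof -
  obtain \<phi> where \<phi>0: "\<phi> 0 = 0"
    and d\<phi>: "\<And>t. 0 \<le> t \<Longrightarrow> (\<phi> has_vector_derivative (1 + t) powr p * c t) (at t within {0..})"
    and \<phi>_lower: "\<And>t. 0 \<le> t \<Longrightarrow> m / (1 + p) * ((1 + t) powr (1 + p) - 1) \<le> \<phi> t"
    using time_change[OF c p low m] by blast
  have \<phi>_nonneg: "0 \<le> \<phi> t" if "0 \<le> t" for t
  proof -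
    have "1 \<le> (1 + t) powr (1 + p)" using that p by (intro ge_one_powr_ge_zero) auto
    then have "0 \<le> m / (1 + p) * ((1 + t) powr (1 + p) - 1)" using m p by simp
    then show ?thesis using \<phi>_lower[OF that] by linarith
  qed
  have \<phi>c: "continuous_on {0..} \<phi>"
    using d\<phi> by (auto simp: continuous_on_eq_continuous_within intro: has_vector_derivative_continuous)
  define w where "w = A u0"
  define u where "u t = R (Phi (heat (\<phi> t)) w)" for t
  have Au: "A (u t) = Phi (heat (\<phi> t)) w" and uD: "u t \<in> D" for t
    by (simp_all add: u_def A_R R_mem)
  have Auc: "continuous_on {0..} (\<lambda>t. A (u t))"
    unfolding Au using \<phi>_nonneg by (intro continuous_on_compose2[OF continuous_on_heat \<phi>c]) auto
  have du: "(u has_vector_derivative - ((1 + t) powr p * c t) *\<^sub>R A (u t)) (at t within {0..})"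
    if t: "0 \<le> t" for t
  proof -
    have "((\<lambda>s. R (Phi (heat s) w)) has_vector_derivative - Phi (heat (\<phi> t)) w)
        (at (\<phi> t) within \<phi> ` {0..})"
      by (rule has_vector_derivative_within_subset[OF R_heat_has_vector_derivative])
        (use \<phi>_nonneg t in auto)
    from vector_diff_chain_within[OF d\<phi>[OF t] this] show ?thesis
      by (simp add: comp_def u_def[abs_def, symmetric] Au)
  qed
  have hd: "half_line_deriv u t = - ((1 + t) powr p * c t) *\<^sub>R A (u t)" if "0 \<le> t" for t
    by (rule vector_derivative_within[OF at_within_half_line_nontrivial[OF that] du[OF that]])
  have uc: "continuous_on {0..} u"
    using du by (auto simp: continuous_on_eq_continuous_within intro: has_vector_derivative_continuous)
  have "continuous_on {0..} (\<lambda>t. - ((1 + t) powr p * c t) *\<^sub>R A (u t))"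
    by (intro continuous_intros c Auc) auto
  then have hdc: "continuous_on {0..} (half_line_deriv u)"
    by (rule continuous_on_eq) (simp add: hd)
  have Adiff: "A (u s - u t) = A (u s) - A (u t)" for s t
  proof -
    have "A (u s + (-1) *\<^sub>R u t) = A (u s) + (-1) *\<^sub>R A (u t)"
      using lin uD[of s] uD[of t] unfolding linear_operator_def by (metis subspace_scale)
    then show ?thesis by simp
  qed
  have graph: "((\<lambda>s. graph_norm A (u s - u t)) \<longlongrightarrow> 0) (at t within {0..})" if t: "0 \<le> t" for t
  proof -
    have "(u \<longlongrightarrow> u t) (at t within {0..})" "((\<lambda>s. A (u s)) \<longlongrightarrow> A (u t)) (at t within {0..})"
      using uc Auc t by (auto simp: continuous_on_def)
    then have "((\<lambda>s. sqrt ((norm (u s - u t))\<^sup>2 + (norm (A (u s) - A (u t)))\<^sup>2)) \<longlongrightarrow>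
        sqrt ((norm (u t - u t))\<^sup>2 + (norm (A (u t) - A (u t)))\<^sup>2)) (at t within {0..})"
      by (intro tendsto_intros)
    then show ?thesis by (simp add: graph_norm_def Adiff)
  qed
  have "global_solution D A p c u0 u"
    unfolding global_solution_def C1_half_line_def continuous_into_domain_def
  proof (intro conjI allI impI)
    fix t :: real assume t: "0 \<le> t"
    show "u differentiable at t within {0..}" using du[OF t] by (rule differentiableI_vector)
    show "(1 / (1 + t) powr p) *\<^sub>R half_line_deriv u t + c t *\<^sub>R A (u t) = 0"
      using t by (simp add: hd)
    show "u t \<in> D" by (rule uD)
    show "((\<lambda>s. graph_norm A (u s - u t)) \<longlongrightarrow> 0) (at t within {0..})" by (rule graph[OF t])
  next
    show "continuous_on {0..} (half_line_deriv u)" by (rule hdc)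
    show "u 0 = u0" using R_A[OF u0] by (simp add: u_def \<phi>0 heat_0 w_def)
  qed
  moreover have "norm (u t) \<le> 1 / \<nu> * norm (A (u t))" for t
    using norm_R_le[of "Phi (heat (\<phi> t)) w"] by (simp add: Au) (simp add: u_def)
  moreover have "norm (A (u t)) \<le>
      exp (- (\<nu> * (m / (1 + p) * ((1 + t) powr (1 + p) - 1)))) * norm (A u0)" if t: "0 \<le> t" for t
  proof -
    have "norm (A (u t)) \<le> exp (- (\<nu> * \<phi> t)) * norm w"
      unfolding Au by (rule norm_heat_le[OF \<phi>_nonneg[OF t]])
    also have "\<dots> \<le> exp (- (\<nu> * (m / (1 + p) * ((1 + t) powr (1 + p) - 1)))) * norm w"
      using mult_left_mono[OF \<phi>_lower[OF t], of \<nu>] nu_pos by (intro mult_right_mono) auto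
    finally show ?thesis by (simp add: w_def)
  qed
  ultimately show thesis using that hd by blast
qed

end

theorem theorem2p8:
  fixes D :: "'a::{real_inner, complete_space} set"
    and A :: "'a \<Rightarrow> 'a"
    and \<nu> p \<mu> M1 :: real
    and u0 :: 'a
    and c :: "real \<Rightarrow> real"
  assumes "self_adjoint_operator D A"
    and "bdd_below {inner (A u) u | u. u \<in> D \<and> norm u = 1}"
    and "\<nu> = Inf {inner (A u) u | u. u \<in> D \<and> norm u = 1}"
    and "\<nu> > 0"
    and "p \<ge> 0"
    and "u0 \<in> D"
    and "continuous_on {0..} c"
    and "\<forall>t\<ge>0. c t > 0"
    and "\<mu> > 0"
    and "\<forall>t\<ge>0. \<mu> \<le> c t \<and> c t \<le> M1"
  shows "\<exists>u. global_solution D A p c u0 u \<and>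
           (\<forall>v. global_solution D A p c u0 v \<longrightarrow> (\<forall>t\<ge>0. v t = u t)) \<and>
           (\<exists>C. \<forall>t\<ge>0.
              (norm (u t))\<^sup>2 + (norm (operator_power D A (1/2) (u t)))\<^sup>2 + (norm (A (u t)))\<^sup>2
                + (norm (half_line_deriv u t))\<^sup>2 / (1 + t) powr (2 * p)
              \<le> C * exp (- (2 * \<mu> * \<nu> / (1 + p)) * (1 + t) powr (1 + p)))"
proof -
  have lin: "linear_operator D A" using assms(1) by (simp add: self_adjoint_operator_def)
  have lower: "\<nu> * (norm x)\<^sup>2 \<le> inner (A x) x" if x: "x \<in> D" for x
  proof (cases "x = 0")
    case False
    define e where "e = (1 / norm x) *\<^sub>R x"
    have "e \<in> D" using lin x unfolding e_def linear_operator_def by (simp add: subspace_scale)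
    moreover have "norm e = 1" using False by (simp add: e_def)
    ultimately have "\<nu> \<le> inner (A e) e" unfolding assms(3) by (intro cInf_lower assms(2)) blast
    also have "A e = (1 / norm x) *\<^sub>R A x" using lin x unfolding e_def linear_operator_def by blast
    finally have "\<nu> \<le> inner (A x) x / (norm x)\<^sup>2" by (simp add: e_def power2_eq_square)
    then show ?thesis using False by (simp add: pos_le_divide_eq)
  qed simp
  have c: "\<And>t. 0 \<le> t \<Longrightarrow> \<mu> \<le> c t" "\<And>t. 0 \<le> t \<Longrightarrow> c t \<le> M1" using assms(10) by auto
  obtain E R where "positive_spectral_family E \<nu> D A R"
    using positive_spectral_family_exists[OF assms(1,4) lower] by blast
  then interpret F: positive_spectral_family E \<nu> D A R .
  obtain u where u: "global_solution D A p c u0 u"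
    and u_le: "\<And>t. 0 \<le> t \<Longrightarrow> norm (u t) \<le> 1 / \<nu> * norm (A (u t))"
    and Au_le: "\<And>t. 0 \<le> t \<Longrightarrow>
      norm (A (u t)) \<le> exp (- (\<nu> * (\<mu> / (1 + p) * ((1 + t) powr (1 + p) - 1)))) * norm (A u0)"
    and hd: "\<And>t. 0 \<le> t \<Longrightarrow> half_line_deriv u t = - ((1 + t) powr p * c t) *\<^sub>R A (u t)"
    using F.solution_exists[OF lin assms(6,7,5) c(1) assms(9)] by blast
  have unique: "v t = u t" if "global_solution D A p c u0 v" "0 \<le> t" for v t
  proof (rule global_solution_unique[OF lin _ _ u that])
    show "0 \<le> inner (A x) x" if "x \<in> D" for x
      using lower[OF that] assms(4) by (meson order_trans mult_nonneg_nonneg less_imp_le zero_le_power2)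
    show "0 \<le> c t" if "0 \<le> t" for t using c(1)[OF that] assms(9) by linarith
  qed
  \<comment> \<open>With \<open>a = (norm (A u))\<^sup>2\<close>, the four terms are at most \<open>a / \<nu>\<^sup>2\<close>, \<open>a / \<nu>\<^sup>2 + a\<close>, \<open>a\<close> and \<open>M1\<^sup>2 * a\<close>. The
    exponential factor of \<open>C\<close> compensates the lower limit \<open>1\<close> in \<open>(1 + t) powr (1 + p) - 1\<close>.\<close>
  define K where "K = 2 / \<nu>\<^sup>2 + 2 + M1\<^sup>2"
  define C where "C = K * (norm (A u0))\<^sup>2 * exp (2 * \<mu> * \<nu> / (1 + p))"
  have "(norm (u t))\<^sup>2 + (norm (operator_power D A (1/2) (u t)))\<^sup>2 + (norm (A (u t)))\<^sup>2
      + (norm (half_line_deriv u t))\<^sup>2 / (1 + t) powr (2 * p)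
      \<le> C * exp (- (2 * \<mu> * \<nu> / (1 + p)) * (1 + t) powr (1 + p))" if t: "0 \<le> t" for t
  proof -
    let ?a = "(norm (A (u t)))\<^sup>2"
    have uD: "u t \<in> D" using u t by (simp add: global_solution_def continuous_into_domain_def)
    have 1: "(norm (u t))\<^sup>2 \<le> ?a / \<nu>\<^sup>2"
      using power_mono[OF u_le[OF t], of 2] by (simp add: power_divide)
    have 2: "(norm (operator_power D A (1/2) (u t)))\<^sup>2 \<le> (norm (u t))\<^sup>2 + ?a"
      using F.is_spectral_measure uD by (intro norm_operator_power_half) auto
    have 3: "(norm (half_line_deriv u t))\<^sup>2 / (1 + t) powr (2 * p) \<le> M1\<^sup>2 * ?a"
    proof -
      have "(1 + t) powr (2 * p) = ((1 + t) powr p)\<^sup>2" using t by (simp add: power2_eq_square powr_add[symmetric])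
      then have "(norm (half_line_deriv u t))\<^sup>2 / (1 + t) powr (2 * p) = (c t)\<^sup>2 * ?a"
        using t by (simp add: hd power_mult_distrib)
      also have "\<dots> \<le> M1\<^sup>2 * ?a"
        using c[OF t] assms(9) by (intro mult_right_mono power_mono) auto
      finally show ?thesis .
    qed
    have "(norm (u t))\<^sup>2 + (norm (operator_power D A (1/2) (u t)))\<^sup>2 + ?a
      + (norm (half_line_deriv u t))\<^sup>2 / (1 + t) powr (2 * p) \<le> 2 * (?a / \<nu>\<^sup>2) + 2 * ?a + M1\<^sup>2 * ?a"
      using 1 2 3 by linarith
    also have "\<dots> = K * ?a" by (simp add: K_def algebra_simps)
    also have "\<dots> \<le> K * ((exp (- (\<nu> * (\<mu> / (1 + p) * ((1 + t) powr (1 + p) - 1)))) * norm (A u0))\<^sup>2)"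
      using Au_le[OF t] by (intro mult_left_mono power_mono) (auto simp: K_def)
    also have "\<dots> = K * (norm (A u0))\<^sup>2 * (exp (- (\<nu> * (\<mu> / (1 + p) * ((1 + t) powr (1 + p) - 1)))))\<^sup>2"
      by (simp add: power_mult_distrib)
    also have "(exp (- (\<nu> * (\<mu> / (1 + p) * ((1 + t) powr (1 + p) - 1)))))\<^sup>2
        = exp (2 * \<mu> * \<nu> / (1 + p)) * exp (- (2 * \<mu> * \<nu> / (1 + p)) * (1 + t) powr (1 + p))"
      unfolding power2_eq_square exp_add[symmetric] using assms(5)
      by (intro arg_cong[where f = exp]) (simp add: field_simps)
    finally show ?thesis by (simp add: C_def mult.assoc)
  qed
  with u unique show ?thesis by blast
qed

end
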